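(* Let $n\in\mathbb{N}=\{1,2,\dots\}$ and $\gamma>0$. Then the set $$E=\bigcup_{j=1}^\infty\partial B(0,j^{-\gamma})\cup\{0\}\subset\mathbb{R}^n$$ is weakly porous, and $\operatorname{Mu}(E)=\min\bigl\{1,\frac{n\gamma}{1+\gamma}\bigr\}$.
   Context: $|\cdot|$ is $n$-dimensional Lebesgue measure; $\operatorname{dist}(x,E)$ is the Euclidean distance; $B(x,r)$ is the open Euclidean ball and $\partial B(x,r)$ its boundary sphere. Cubes: a cube is a half-open set $Q=[a_1,b_1)\times\cdots\times[a_n,b_n)$ with all sides of equal length $\ell(Q)=b_i-a_i>0$. For a cube $P$ and $j\ge 0$, $\mathcal{D}_j(P)$ is the collection of the $2^{jn}$ pairwise disjoint half-open cubes of side length $2^{-j}\ell(P)$ whose union is $P$, and $\mathcal{D}(P)=\bigcup_{j\ge0}\mathcal{D}_j(P)$. Weak porosity: let $E\subset\mathbb{R}^n$ be nonempty. A cube $Q\in\mathcal{D}(P)$ is $E$-free if $E\cap Q=\emptyset$. $\mathcal{M}(P)\in\mathcal{D}(P)$ denotes a (fixed choice of a) largest $E$-free dyadic subcube of $P$. $E$ is weakly porous if there are constants $0<c,\delta<1$ such that for every cube $P\subset\mathbb{R}^n$ there exist $N\in\mathbb{N}$ and pairwise disjoint $E$-free cubes $Q_1,\dots,Q_N\in\mathcal{D}(P)$ with $|Q_k|\ge\delta|\mathcal{M}(P)|$ for all $k$ and $\sum_{k=1}^N|Q_k|\ge c|P|$ (in particular, every cube $P$ is required to have an $E$-free dyadic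 subcube). Muckenhoupt exponent: for a ball $B(x,r)$, $h_E(B(x,r))$ is the supremum of all $t>0$ such that $B(y,t)\subset B(x,r)\setminus E$ for some $y\in B(x,r)$, and $h_E(B(x,r))=0$ if there is no such $t$. Let $E_r=\{y\in\mathbb{R}^n:\operatorname{dist}(y,E)<r\}$. If $h_E(B(x,R))>0$ for every $x\in E$ and $R>0$, then $\operatorname{Mu}(E)$ is the supremum of the numbers $\alpha\in\mathbb{R}$ for which there is a constant $C$ such that $$\frac{|E_r\cap B(x,R)|}{|B(x,R)|}\le C\Bigl(\frac{h_E(B(x,R))}{r}\Bigr)^{-\alpha}$$ for every $x\in E$ and $0<r<h_E(B(x,R))\le R$. If $h_E(B(x,R))=0$ for some $x\in E$ and $R>0$, then $\operatorname{Mu}(E)=0$. *)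

theory Defs
  imports "HOL-Analysis.Analysis"
begin

definition half_open_cube :: "real ^ 'n \<Rightarrow> real \<Rightarrow> (real ^ 'n) set" where
  "half_open_cube a l = {x. \<forall>i. a $ i \<le> x $ i \<and> x $ i < a $ i + l}"

definition is_cube :: "(real ^ 'n) set \<Rightarrow> bool" where
  "is_cube P \<longleftrightarrow> (\<exists>a l. l > 0 \<and> P = half_open_cube a l)"

(* The corner a and the side length l > 0 are determined by the cube P; the multi-index k
   runs through the 2 ^ (j * n) positions of the subcubes. *)
definition dyadic_gen :: "nat \<Rightarrow> (real ^ 'n) set \<Rightarrow> (real ^ 'n) set set" where
  "dyadic_gen j P =
     {half_open_cube (\<chi> i. a $ i + real (k i) * (l / 2 ^ j)) (l / 2 ^ j) | a l k.
        l > 0 \<and> P = half_open_cube a l \<and> (\<forall>i. k i < (2::nat) ^ j)}"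

definition dyadic :: "(real ^ 'n) set \<Rightarrow> (real ^ 'n) set set" where
  "dyadic P = (\<Union>j. dyadic_gen j P)"

(* A fixed choice of a largest E-free dyadic subcube of P. It is an arbitrary set if P has no
   E-free dyadic subcube; weakly_porous excludes that case, as its sum is required to be
   positive. *)
definition max_free_cube :: "(real ^ 'n) set \<Rightarrow> (real ^ 'n) set \<Rightarrow> (real ^ 'n) set" where
  "max_free_cube E P = arg_max (measure lebesgue) (\<lambda>Q. Q \<in> dyadic P \<and> E \<inter> Q = {})"

definition weakly_porous :: "(real ^ 'n) set \<Rightarrow> bool" where
  "weakly_porous E \<longleftrightarrow> E \<noteq> {} \<and>
     (\<exists>c \<delta>::real. 0 < c \<and> c < 1 \<and> 0 < \<delta> \<and> \<delta> < 1 \<and>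
       (\<forall>P. is_cube P \<longrightarrow>
         (\<exists>N\<ge>1. \<exists>Q :: nat \<Rightarrow> (real ^ 'n) set.
            (\<forall>k\<in>{1..N}. Q k \<in> dyadic P \<and> E \<inter> Q k = {} \<and>
               measure lebesgue (Q k) \<ge> \<delta> * measure lebesgue (max_free_cube E P)) \<and>
            disjoint_family_on Q {1..N} \<and>
            (\<Sum>k=1..N. measure lebesgue (Q k)) \<ge> c * measure lebesgue P)))"

(* h_E(B(x,r)), as a function of the centre and the radius. The supremum is over a set
   bounded above by r. *)
definition hole_radius :: "(real ^ 'n) set \<Rightarrow> real ^ 'n \<Rightarrow> real \<Rightarrow> real" where
  "hole_radius E x r =
     (let T = {t. t > 0 \<and> (\<exists>y\<in>ball x r. ball y t \<subseteq> ball x r - E)}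
      in if T = {} then 0 else Sup T)"

definition nbhd :: "(real ^ 'n) set \<Rightarrow> real \<Rightarrow> (real ^ 'n) set" where
  "nbhd E r = {y. infdist y E < r}"

(* Extended-real valued, so that the supremum is meaningful without a boundedness argument. *)
definition Mu :: "(real ^ 'n) set \<Rightarrow> ereal" where
  "Mu E =
     (if \<forall>x\<in>E. \<forall>R>0. hole_radius E x R > 0
      then Sup (ereal ` {\<alpha>. \<exists>C::real. \<forall>x\<in>E. \<forall>r R.
             0 < r \<and> r < hole_radius E x R \<and> hole_radius E x R \<le> R \<longrightarrow>
             measure lebesgue (nbhd E r \<inter> ball x R) / measure lebesgue (ball x R)
               \<le> C * (hole_radius E x R / r) powr (- \<alpha>)})
      else 0)"

end

theory Submission
  imports Defs
begin

text \<open>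
  Put \<open>\<beta> = 1 + 1 / \<gamma>\<close>. Consecutive radii \<open>j powr - \<gamma>\<close> near a radius \<open>t\<close> are separated by a gap
  comparable to \<open>t powr \<beta>\<close>, and the whole proof rests on this property of the radii. It is isolated
  in the locale \<open>power_gaps\<close>, for the set \<open>spheres T\<close> of all points whose norm lies in a set \<open>T\<close> of
  radii; the result there is \<open>Mu = min 1 (n / \<beta>)\<close>, and \<open>n / \<beta> = n \<gamma> / (1 + \<gamma>)\<close>.

  A ball of centre \<open>x\<close> and radius \<open>R\<close> has a natural scale, \<open>gap_scale x R = min R ((|x| + R) powr \<beta>)\<close>:
  up to a constant, the size of the largest gap that it can contain. Two estimates, which hold for all balls, whether
  centred on the set or not, carry the argument.

  \<^item> Every point \<open>y\<close> is within \<open>K * |y| powr \<beta>\<close> of the set (\<open>infdist_spheres_le\<close>). Hence holes in the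
    ball have radius at most \<open>K * gap_scale x R\<close> (\<open>free_ball_radius_le\<close>).
  \<^item> For \<open>0 \<le> \<alpha> \<le> 1\<close> with \<open>\<alpha> \<beta> < n\<close>, the \<open>r\<close>-neighbourhood of the set fills at most the proportion
    \<open>C * (r / gap_scale x R) powr \<alpha>\<close> of the ball (\<open>nbhd_density\<close>).

  The density estimate avoids polar coordinates. In an annulus \<open>s / 2 \<le> |y| \<le> 2 s\<close> the gaps have
  length at least a constant times \<open>s powr \<beta>\<close>, so a piece of the neighbourhood lying there has about
  \<open>s powr \<beta> / r\<close> pairwise disjoint dilates, none of smaller measure than the original, that stay close
  to it (\<open>dilation_estimate\<close>). This bounds the piece by the case \<open>\<alpha> = 1\<close> of the estimate, and
  the trivial bound by the measure of the ball interpolates to all smaller \<open>\<alpha>\<close>. A ball that is small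
  compared with its distance to the origin lies in one such annulus. Any other ball lies in
  a ball around the origin of comparable radius, and is cut into dyadic shells; the bounds for the
  shells form a geometric series with ratio \<open>2 powr (\<alpha> \<beta> - n) < 1\<close>.

  Both claims follow. With some small \<open>\<alpha> > 0\<close>, the neighbourhood of width \<open>b * gap_scale x R\<close>
  fills less than a given proportion of each ball once \<open>b\<close> is small; so at least half of a cube is
  filled by free dyadic subcubes of side comparable to the gap scale, while no free subcube can be much
  larger (\<open>weakly_porousI\<close>). The same fact shows that all balls have holes. The two estimates
  together give the Muckenhoupt inequality for all \<open>\<alpha> < min 1 (n / \<beta>)\<close>. Conversely, the ball of radius
  2 around the origin witnesses that no larger \<open>\<alpha>\<close> is possible: the \<open>r\<close>-neighbourhood contains a shell
  of width \<open>r\<close> around the unit sphere, of measure at least a constant times \<open>r\<close>, and the ball around the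
  origin in which all gaps are shorter than \<open>r\<close>, of measure comparable to \<open>r powr (n / \<beta>)\<close>.
\<close>

section \<open>Packing by dilates\<close>

lemma measure_lebesgue_scaleR:
  fixes A :: "(real ^ 'n) set"
  shows "measure lebesgue ((*\<^sub>R) m ` A) = \<bar>m\<bar> ^ CARD('n) * measure lebesgue A"
  using measure_lebesgue_affine[of m "0 :: real ^ 'n" A] by simp

lemma lmeasurable_scaleR:
  fixes A :: "(real ^ 'n) set"
  assumes "A \<in> lmeasurable" "m \<noteq> 0"
  shows "(*\<^sub>R) m ` A \<in> lmeasurable"
proof (rule fmeasurableI)
  have "(*\<^sub>R) m ` A = (*\<^sub>R) (1 / m) -` A \<inter> space lebesgue"
    using assms(2) by (force simp: image_iff)
  also have "\<dots> \<in> sets lebesgue"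
    using assms(1) by (intro measurable_sets[OF lebesgue_measurable_scaling]) auto
  finally show "(*\<^sub>R) m ` A \<in> sets lebesgue" .
  show "emeasure lebesgue ((*\<^sub>R) m ` A) < \<infinity>"
    using emeasure_lebesgue_affine[of m "0 :: real ^ 'n" A] assms(1)
    by (simp add: fmeasurable_def ennreal_mult_less_top del: emeasure_completion)
qed

text \<open>The set \<open>A\<close> sits in the \<open>r\<close>-neighbourhoods of spheres whose radii differ by at least \<open>m\<close>. Dilating it by
  \<open>1 + k \<tau>\<close> with \<open>\<tau> = 8 * r / s\<close> moves each point by more than \<open>2 * r\<close> at each step, so a dilate
  leaves the neighbourhood of its own sphere; with about \<open>m / (32 * r)\<close> steps it moves at most \<open>m / 2\<close>
  and does not reach the neighbourhood of the next one. The dilates are therefore disjoint subsets of \<open>D\<close>, each of measure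
  at least that of \<open>A\<close>.\<close>

lemma dilation_estimate:
  fixes A D :: "(real ^ 'n) set"
  assumes A: "A \<in> lmeasurable" and D: "D \<in> lmeasurable"
    and r: "r > 0" and m: "m > 0" "m \<le> s"
    and annulus: "\<And>y. y \<in> A \<Longrightarrow> s / 2 \<le> norm y \<and> norm y \<le> 2 * s"
    and near: "\<And>y. y \<in> A \<Longrightarrow> \<exists>t\<in>T. \<bar>norm y - t\<bar> < r"
    and sep: "\<And>t t'. t \<in> T \<Longrightarrow> t' \<in> T \<Longrightarrow> s / 4 \<le> t \<Longrightarrow> t < t' \<Longrightarrow> m \<le> t' - t"
    and thick: "\<And>y. y \<in> A \<Longrightarrow> cball y (m / 2) \<subseteq> D"
  shows "m * measure lebesgue A \<le> 32 * r * measure lebesgue D"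
proof (cases "m < 32 * r")
  case True
  \<comment> \<open>There is room for a single copy only, but then \<open>A \<subseteq> D\<close> is enough.\<close>
  have "A \<subseteq> D"
    using thick m by fastforce
  then have "measure lebesgue A \<le> measure lebesgue D"
    using A D by (intro measure_mono_fmeasurable) auto
  with True m show ?thesis
    by (intro mult_mono) auto
next
  case False
  define N where "N = nat \<lfloor>m / (32 * r)\<rfloor>"
  define \<tau> where "\<tau> = 8 * r / s"
  define \<mu> where "\<mu> k = 1 + real k * \<tau>" for k :: nat
  have s: "s > 0" using m by simp
  have \<tau>: "\<tau> > 0" using r s by (simp add: \<tau>_def)
  have "real N \<le> m / (32 * r)"
    using m r by (simp add: N_def)
  then have N\<tau>: "real N * \<tau> \<le> m / (4 * s)"
    using r s by (simp add: \<tau>_def field_simps)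
  have N_ge: "m / (32 * r) \<le> real N + 1"
    using m r unfolding N_def by (simp add: of_nat_nat)
  have k\<tau>: "real k * \<tau> \<le> m / (4 * s)" "real k * \<tau> \<ge> 0" if "k \<le> N" for k
  proof -
    have "real k * \<tau> \<le> real N * \<tau>"
      using that \<tau> by (intro mult_right_mono) auto
    then show "real k * \<tau> \<le> m / (4 * s)" using N\<tau> by linarith
  qed (use \<tau> in auto)
  have quarter: "m / (4 * s) \<le> 1 / 4"
    using m s by (simp add: field_simps)
  have sub: "(*\<^sub>R) (\<mu> k) ` A \<subseteq> D" if k: "k \<le> N" for k
  proof
    fix z assume "z \<in> (*\<^sub>R) (\<mu> k) ` A"
    then obtain y where y: "y \<in> A" "z = \<mu> k *\<^sub>R y" by auto
    have "dist y z = norm ((real k * \<tau>) *\<^sub>R y)"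
      by (simp add: y \<mu>_def dist_norm algebra_simps)
    also have "\<dots> = real k * \<tau> * norm y"
      using \<tau> by simp
    also have "\<dots> \<le> m / (4 * s) * (2 * s)"
      using k\<tau>[OF k] annulus[OF y(1)] m s by (intro mult_mono) auto
    also have "\<dots> = m / 2" using s by simp
    finally show "z \<in> D" using thick[OF y(1)] by auto
  qed
  have disj: "disjnt ((*\<^sub>R) (\<mu> k) ` A) ((*\<^sub>R) (\<mu> l) ` A)" if kl: "k < l" "l \<le> N" for k l
    unfolding disjnt_iff
  proof (intro allI notI, elim conjE imageE)
    fix z y y' assume y: "y \<in> A" "y' \<in> A" and "z = \<mu> k *\<^sub>R y" "z = \<mu> l *\<^sub>R y'"
    then have eq: "\<mu> k *\<^sub>R y = \<mu> l *\<^sub>R y'" by simp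
    \<comment> \<open>The difference of the norms lies between \<open>2 * r\<close> and \<open>m / 2\<close>, which is possible neither for points
      near the same sphere nor for points near different ones.\<close>
    define d where "d = norm y - norm y'"
    have "\<mu> k * norm y = \<mu> l * norm y'"
      using arg_cong[OF eq, of norm] \<tau> by (simp add: \<mu>_def)
    then have d: "d * (1 + real k * \<tau>) = (real l - real k) * \<tau> * norm y'"
      by (simp add: d_def \<mu>_def algebra_simps)
    have pos: "(real l - real k) * \<tau> * norm y' \<ge> 0"
      using kl \<tau> by simp
    have k1: "1 + real k * \<tau> \<ge> 1" "1 + real k * \<tau> \<le> 5 / 4"
      using k\<tau>[of k] kl quarter by auto
    have d0: "d \<ge> 0"
      using pos k1 d by (metis linorder_not_less mult_neg_pos not_less_iff_gr_or_eq order_less_le_trans zero_less_one)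
    have "4 * r = 1 * \<tau> * (s / 2)"
      using s by (simp add: \<tau>_def)
    also have "\<dots> \<le> (real l - real k) * \<tau> * norm y'"
      using kl annulus[OF y(2)] \<tau> s by (intro mult_mono) auto
    also have "\<dots> \<le> d * (5 / 4)"
      unfolding d[symmetric] using d0 k1 by (intro mult_left_mono) auto
    finally have d_ge: "d > 2 * r" using r by simp
    have "d * 1 \<le> d * (1 + real k * \<tau>)"
      using d0 k1 by (intro mult_left_mono) auto
    also have "\<dots> = (real l - real k) * \<tau> * norm y'" by (rule d)
    also have "\<dots> \<le> real l * \<tau> * (2 * s)"
      using kl annulus[OF y(2)] \<tau> s by (intro mult_mono) auto
    also have "\<dots> \<le> m / (4 * s) * (2 * s)"
      using k\<tau>[OF kl(2)] s by (intro mult_right_mono) auto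
    also have "\<dots> = m / 2" using s by simp
    finally have d_le: "d \<le> m / 2" by simp
    obtain t t' where t: "t \<in> T" "t' \<in> T" "\<bar>norm y - t\<bar> < r" "\<bar>norm y' - t'\<bar> < r"
      using near y by blast
    have "s / 4 \<le> t'"
      using annulus[OF y(2)] t(4) False m s by linarith
    moreover have "t' < t"
      using d_ge t(3,4) unfolding d_def by linarith
    ultimately have "m \<le> t - t'" using sep t by blast
    moreover have "t - t' < d + 2 * r"
      using t(3,4) unfolding d_def by linarith
    ultimately show False using d_le False m by linarith
  qed
  have lm: "(*\<^sub>R) (\<mu> k) ` A \<in> lmeasurable" for k
    using \<tau> by (intro lmeasurable_scaleR A) (simp add: \<mu>_def add_nonneg_eq_0_iff)
  have "m / (32 * r) * measure lebesgue A \<le> (real N + 1) * measure lebesgue A"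
    using N_ge by (intro mult_right_mono) auto
  also have "\<dots> = (\<Sum>k\<le>N. measure lebesgue A)" by simp
  also have "\<dots> \<le> (\<Sum>k\<le>N. measure lebesgue ((*\<^sub>R) (\<mu> k) ` A))"
  proof (intro sum_mono)
    fix k
    have "1 \<le> \<bar>\<mu> k\<bar> ^ CARD('n)"
      using \<tau> by (intro one_le_power) (simp add: \<mu>_def)
    from mult_right_mono[OF this, of "measure lebesgue A"]
    show "measure lebesgue A \<le> measure lebesgue ((*\<^sub>R) (\<mu> k) ` A)"
      by (simp add: measure_lebesgue_scaleR)
  qed
  also have "\<dots> = measure lebesgue (\<Union>k\<le>N. (*\<^sub>R) (\<mu> k) ` A)"
    using disj lm
    by (intro measure_UNION'[symmetric])
       (auto simp: pairwise_def, metis disjnt_sym linorder_neqE_nat)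
  also have "\<dots> \<le> measure lebesgue D"
    using sub lm D by (intro measure_mono_fmeasurable fmeasurableD fmeasurable.finite_UN) auto
  finally show ?thesis using r by (simp add: field_simps)
qed

section \<open>Sets of radii with power gaps\<close>

lemma reciprocal_power_difference:
  fixes \<gamma> x :: real
  assumes "\<gamma> > 0" "x > 0"
  shows "\<gamma> * (x + 1) powr (- \<gamma> - 1) \<le> x powr - \<gamma> - (x + 1) powr - \<gamma>"
    and "x powr - \<gamma> - (x + 1) powr - \<gamma> \<le> \<gamma> * x powr (- \<gamma> - 1)"
proof -
  have "\<exists>z>x. z < x + 1 \<and> (x + 1) powr - \<gamma> - x powr - \<gamma> = (x + 1 - x) * (- \<gamma> * z powr (- \<gamma> - 1))"
    using assms by (intro MVT2) (auto intro!: derivative_eq_intros)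
  then obtain z where z: "x < z" "z < x + 1"
    "x powr - \<gamma> - (x + 1) powr - \<gamma> = \<gamma> * z powr (- \<gamma> - 1)"
    by (auto simp: algebra_simps)
  have "(x + 1) powr (- \<gamma> - 1) \<le> z powr (- \<gamma> - 1)" "z powr (- \<gamma> - 1) \<le> x powr (- \<gamma> - 1)"
    using z assms by (auto intro!: powr_mono2')
  then show "\<gamma> * (x + 1) powr (- \<gamma> - 1) \<le> x powr - \<gamma> - (x + 1) powr - \<gamma>"
    "x powr - \<gamma> - (x + 1) powr - \<gamma> \<le> \<gamma> * x powr (- \<gamma> - 1)"
    unfolding z(3) using assms by auto
qed

definition spheres :: "real set \<Rightarrow> (real ^ 'n) set" where
  "spheres T = {y. norm y \<in> T}"

text \<open>The gap above a positive radius \<open>t\<close> has length at least \<open>c * t powr \<beta>\<close>, and every \<open>u > 0\<close> has a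
  radius at distance at most \<open>K * u powr \<beta>\<close> below it.\<close>

locale power_gaps =
  fixes T :: "real set" and \<beta> c K :: real
  assumes zero_mem: "0 \<in> T" and one_mem: "1 \<in> T"
    and exponent: "\<beta> > 1" and c_pos: "c > 0" and K_ge_1: "K \<ge> 1"
    and gap_ge: "\<And>t t'. t \<in> T \<Longrightarrow> t' \<in> T \<Longrightarrow> 0 < t \<Longrightarrow> t < t' \<Longrightarrow> c * t powr \<beta> \<le> t' - t"
    and gap_le: "\<And>u. u > 0 \<Longrightarrow> \<exists>t\<in>T. 0 \<le> t \<and> t \<le> u \<and> u - t \<le> K * u powr \<beta>"

text \<open>By the mean value theorem the gaps on both sides of \<open>j powr - \<gamma>\<close> (for \<open>j = 1\<close>, the gap below) have
  length comparable to \<open>j powr (- \<gamma> - 1)\<close>, which is \<open>j powr - \<gamma>\<close> raised to the exponent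
  \<open>\<beta> = 1 + 1 / \<gamma>\<close>. Beyond the largest radius 1, the upper bound holds because \<open>u \<le> u powr \<beta>\<close>.\<close>

lemma power_gaps_reciprocal_powers:
  assumes "\<gamma> > 0"
  shows "power_gaps (insert 0 ((\<lambda>j. real j powr - \<gamma>) ` {1..})) (1 + 1 / \<gamma>) \<gamma>
           (max 1 (\<gamma> * 2 powr (\<gamma> + 1)))"
proof
  let ?T = "insert 0 ((\<lambda>j. real j powr - \<gamma>) ` {1::nat..})"
  have powr_powr_\<beta>: "(x powr - \<gamma>) powr (1 + 1 / \<gamma>) = x powr (- \<gamma> - 1)" for x :: real
  proof -
    have "- \<gamma> * (1 + 1 / \<gamma>) = - \<gamma> - 1"
      using assms by (simp add: field_simps)
    then show ?thesis by (simp add: powr_powr)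
  qed
  show "1 \<in> ?T" by (auto intro!: image_eqI[of _ _ 1])
  show "\<gamma> * t powr (1 + 1 / \<gamma>) \<le> t' - t"
    if asm: "t \<in> ?T" "t' \<in> ?T" "0 < t" "t < t'" for t t'
  proof -
    obtain j i :: nat where ji: "t = real j powr - \<gamma>" "t' = real i powr - \<gamma>" "j \<ge> 1" "i \<ge> 1"
      using asm by auto
    have "i < j"
    proof (rule ccontr)
      assume "\<not> i < j"
      then have "real i powr - \<gamma> \<le> real j powr - \<gamma>"
        using ji assms by (intro powr_mono2') auto
      with asm ji show False by simp
    qed
    then have "real i \<le> real j - 1" and "j \<ge> 2" using ji by auto
    then have "(real j - 1) powr - \<gamma> \<le> t'"
      unfolding ji using assms ji by (intro powr_mono2') auto
    moreover have "\<gamma> * real j powr (- \<gamma> - 1) \<le> (real j - 1) powr - \<gamma> - t"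
      using reciprocal_power_difference(1)[of \<gamma> "real j - 1"] assms \<open>j \<ge> 2\<close> by (simp add: ji)
    ultimately show ?thesis by (simp add: ji powr_powr_\<beta>)
  qed
  show "\<exists>t\<in>?T. 0 \<le> t \<and> t \<le> u \<and> u - t \<le> max 1 (\<gamma> * 2 powr (\<gamma> + 1)) * u powr (1 + 1 / \<gamma>)"
    if u: "u > 0" for u
  proof (cases "u \<ge> 1")
    case True
    have "u - 1 \<le> 1 * u powr 1" using u by simp
    also have "\<dots> \<le> max 1 (\<gamma> * 2 powr (\<gamma> + 1)) * u powr (1 + 1 / \<gamma>)"
      using True assms by (intro mult_mono powr_mono) auto
    finally show ?thesis using True \<open>1 \<in> ?T\<close> by (intro bexI[of _ 1]) auto
  next
    case False
    \<comment> \<open>The real index \<open>v\<close> at which \<open>v powr - \<gamma> = u\<close>; the radius wanted has index \<open>j + 1\<close>, where \<open>j\<close> is the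
      integer part of \<open>v\<close>, and \<open>j \<ge> v / 2\<close>.\<close>
    define v where "v = u powr (- 1 / \<gamma>)"
    define j where "j = nat \<lfloor>v\<rfloor>"
    have v\<gamma>: "v powr - \<gamma> = u" using u assms by (simp add: v_def powr_powr)
    have "v \<ge> 1"
      using powr_mono2'[of "- 1 / \<gamma>" u 1] False u assms by (simp add: v_def)
    then have j: "j \<ge> 1" "real j \<le> v" "v < real j + 1"
      by (auto simp: j_def le_nat_iff of_nat_nat)
    let ?t = "(real j + 1) powr - \<gamma>"
    have "?t \<le> v powr - \<gamma>" "v powr - \<gamma> \<le> real j powr - \<gamma>"
      using j assms by (intro powr_mono2'; simp)+
    then have t: "?t \<le> u" "u \<le> real j powr - \<gamma>"
      by (simp_all add: v\<gamma>)
    have "u - ?t \<le> \<gamma> * real j powr (- \<gamma> - 1)"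
      using reciprocal_power_difference(2)[of \<gamma> "real j"] assms t j by simp
    also have "\<dots> \<le> \<gamma> * (v / 2) powr (- \<gamma> - 1)"
    proof -
      have "v / 2 \<le> real j" using j by linarith
      then show ?thesis
        using assms \<open>v \<ge> 1\<close> by (intro mult_left_mono powr_mono2') auto
    qed
    also have "(v / 2) powr (- \<gamma> - 1) = 2 powr (\<gamma> + 1) * v powr (- \<gamma> - 1)"
      using \<open>v \<ge> 1\<close> by (simp add: powr_divide powr_diff powr_add powr_minus field_simps)
    also have "v powr (- \<gamma> - 1) = u powr (1 + 1 / \<gamma>)"
      using powr_powr_\<beta>[of v] by (simp add: v\<gamma>)
    finally have "u - ?t \<le> \<gamma> * 2 powr (\<gamma> + 1) * u powr (1 + 1 / \<gamma>)" by simp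
    also have "\<dots> \<le> max 1 (\<gamma> * 2 powr (\<gamma> + 1)) * u powr (1 + 1 / \<gamma>)"
      by (intro mult_right_mono) auto
    finally have bound: "u - ?t \<le> max 1 (\<gamma> * 2 powr (\<gamma> + 1)) * u powr (1 + 1 / \<gamma>)" .
    have "?t \<in> ?T"
      by (intro insertI2 image_eqI[of _ _ "Suc j"]) (auto simp: add.commute)
    with bound t(1) show ?thesis by (intro bexI[of _ ?t]) auto
  qed
qed (use assms in auto)

section \<open>Holes and neighbourhoods\<close>

lemma measure_ball_eq:
  fixes x :: "real ^ 'n"
  assumes "R \<ge> 0"
  shows "measure lebesgue (ball x R) = measure lebesgue (ball (0 :: real ^ 'n) 1) * R ^ CARD('n)"
  using content_ball_conv_unit_ball[of R x] assms by simp

lemma divide_le_mult_divide: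
  fixes H M k r b :: real
  assumes "0 < H" "0 < M" "0 \<le> r" "H \<le> k * M" "0 \<le> b"
  shows "b * (r / M) \<le> b * (k * (r / H))"
proof (rule mult_left_mono)
  have "r * H / (M * H) \<le> r * (k * M) / (M * H)"
    using assms by (intro divide_right_mono mult_left_mono) auto
  then show "r / M \<le> k * (r / H)"
    using assms by (simp add: mult_ac)
qed (rule assms)

lemma open_nbhd: "open (nbhd E r)"
  unfolding nbhd_def by (intro open_Collect_less continuous_intros)

lemma lmeasurable_nbhd_Int_ball: "nbhd E r \<inter> ball x R \<in> lmeasurable"
  by (intro lmeasurable_open open_Int open_nbhd bounded_Int) auto

lemma near_sphere_if_in_nbhd:
  fixes y :: "real ^ 'n"
  assumes "y \<in> nbhd (spheres T) r" "spheres T \<noteq> ({} :: (real ^ 'n) set)"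
  shows "\<exists>t\<in>T. \<bar>norm y - t\<bar> < r"
proof -
  obtain z where z: "z \<in> spheres T" "dist y z < r"
    using assms infdist_notempty[of "spheres T" y] cInf_lessD[of "dist y ` spheres T" r]
    by (auto simp: nbhd_def)
  then have "\<bar>norm y - norm z\<bar> < r"
    using norm_triangle_ineq3[of y z] by (simp add: dist_norm)
  then show ?thesis
    using z(1) unfolding spheres_def by blast
qed

context power_gaps
begin

lemma spheres_nonempty: "spheres T \<noteq> {}"
  using zero_mem by (auto simp: spheres_def intro!: exI[of _ 0])

text \<open>Moving radially inwards to the next sphere already achieves the bound.\<close>

lemma infdist_spheres_le:
  fixes y :: "real ^ 'n"
  shows "infdist y (spheres T) \<le> K * norm y powr \<beta>"
proof (cases "y = 0")
  case True
  then show ?thesis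
    using zero_mem by (simp add: spheres_def)
next
  case False
  then obtain t where t: "t \<in> T" "0 \<le> t" "t \<le> norm y" "norm y - t \<le> K * norm y powr \<beta>"
    using gap_le[of "norm y"] by auto
  define z where "z = (t / norm y) *\<^sub>R y"
  have "z \<in> spheres T"
    using t False by (simp add: z_def spheres_def)
  moreover have "dist y z = norm y - t"
  proof -
    have "y - z = ((norm y - t) / norm y) *\<^sub>R y"
      using False by (simp add: z_def diff_divide_distrib scaleR_left_diff_distrib)
    then show ?thesis
      using t False by (simp add: dist_norm)
  qed
  ultimately show ?thesis
    using infdist_le[of z "spheres T" y] t by simp
qed

text \<open>Up to a constant factor, the largest radius that a hole in the ball \<open>ball x R\<close> can have.\<close>

definition gap_scale :: "real ^ 'n \<Rightarrow> real \<Rightarrow> real" where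
  "gap_scale x R = min R ((norm x + R) powr \<beta>)"

lemma gap_scale_pos: "R > 0 \<Longrightarrow> gap_scale x R > 0"
  using add_nonneg_pos[OF norm_ge_zero, of R x] by (simp add: gap_scale_def)

lemma gap_scale_le: "gap_scale x R \<le> R"
  by (simp add: gap_scale_def)

lemma free_ball_radius_le:
  fixes x y :: "real ^ 'n"
  assumes "y \<in> ball x R" "t \<le> R" "ball y t \<inter> spheres T = {}"
  shows "t \<le> K * gap_scale x R"
proof (cases "t > 0")
  case True
  have "t \<le> infdist y (spheres T)"
    unfolding infdist_notempty[OF spheres_nonempty]
    using assms spheres_nonempty by (intro cINF_greatest) force+
  also have "\<dots> \<le> K * norm y powr \<beta>" by (rule infdist_spheres_le)
  also have "\<dots> \<le> K * (norm x + R) powr \<beta>"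
  proof (intro mult_left_mono powr_mono2)
    show "norm y \<le> norm x + R"
      using assms(1) norm_triangle_ineq4[of x "x - y"] by (simp add: dist_norm)
  qed (use exponent K_ge_1 in auto)
  finally have "t \<le> K * (norm x + R) powr \<beta>" .
  moreover have "t \<le> K * R"
    using mult_mono[OF K_ge_1 assms(2)] True K_ge_1 by simp
  ultimately show ?thesis
    by (simp add: gap_scale_def min_def)
next
  case False
  have "0 < R" using assms(1) zero_le_dist[of x y] unfolding mem_ball by linarith
  then have "0 \<le> K * gap_scale x R"
    using gap_scale_pos[of R x] K_ge_1 by simp
  with False show ?thesis by linarith
qed

text \<open>Chosen such that radii above \<open>s / 4\<close> are separated by at least \<open>\<kappa> * s powr \<beta>\<close>, and capped at 1
  so that \<open>\<kappa> * min \<rho> (s powr \<beta>)\<close> does not exceed \<open>\<rho>\<close>.\<close>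

definition \<kappa> :: real where "\<kappa> = min 1 (c / 4 powr \<beta>)"

lemma \<kappa>_pos: "\<kappa> > 0"
  using c_pos by (simp add: \<kappa>_def)

text \<open>The dilation estimate bounds the ratio of the measures by \<open>z = 32 * r / m\<close>, and inclusion bounds it by 1.
  Since \<open>min 1 z \<le> z powr \<alpha>\<close> for \<open>0 \<le> \<alpha> \<le> 1\<close>, it is bounded by \<open>z powr \<alpha>\<close>.\<close>

lemma annulus_density:
  fixes A D :: "(real ^ 'n) set"
  assumes A: "A \<in> lmeasurable" "A \<subseteq> nbhd (spheres T) r" and D: "D \<in> lmeasurable"
    and pos: "r > 0" "\<rho> > 0" "\<rho> \<le> s" and \<alpha>: "0 \<le> \<alpha>" "\<alpha> \<le> 1"
    and annulus: "\<And>y. y \<in> A \<Longrightarrow> s / 2 \<le> norm y \<and> norm y \<le> 2 * s"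
    and thick: "\<And>y. y \<in> A \<Longrightarrow> ball y \<rho> \<subseteq> D"
  shows "measure lebesgue A \<le> measure lebesgue D * (32 / \<kappa> * (r / min \<rho> (s powr \<beta>))) powr \<alpha>"
proof -
  define m where "m = \<kappa> * min \<rho> (s powr \<beta>)"
  define z where "z = 32 * r / m"
  have s: "s > 0" using pos by simp
  have m: "m > 0" using pos s \<kappa>_pos by (simp add: m_def)
  have \<kappa>_le: "\<kappa> \<le> 1" "\<kappa> \<le> c / 4 powr \<beta>" by (auto simp: \<kappa>_def)
  have m_le_\<rho>: "m \<le> \<rho>"
    using mult_mono[OF \<kappa>_le(1), of "min \<rho> (s powr \<beta>)" \<rho>] pos by (simp add: m_def)
  have "m \<le> c / 4 powr \<beta> * s powr \<beta>"
    unfolding m_def using \<kappa>_le \<kappa>_pos c_pos pos by (intro mult_mono) auto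
  also have "\<dots> = c * (s / 4) powr \<beta>"
    using s by (simp add: powr_divide)
  finally have m_le_gap: "m \<le> c * (s / 4) powr \<beta>" .
  have "m * measure lebesgue A \<le> 32 * r * measure lebesgue D"
  proof (rule dilation_estimate[where s = s and T = T])
    show "\<exists>t\<in>T. \<bar>norm y - t\<bar> < r" if "y \<in> A" for y
      using near_sphere_if_in_nbhd A(2) that spheres_nonempty by blast
    show "m \<le> t' - t" if "t \<in> T" "t' \<in> T" "s / 4 \<le> t" "t < t'" for t t'
    proof -
      have "c * (s / 4) powr \<beta> \<le> c * t powr \<beta>"
        using that s c_pos exponent by (intro mult_left_mono powr_mono2) auto
      then show ?thesis
        using m_le_gap gap_ge[of t t'] that s by linarith
    qed
    show "cball y (m / 2) \<subseteq> D" if "y \<in> A" for y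
      using thick[OF that] m_le_\<rho> m by (force simp: subset_iff)
  qed (use assms m m_le_\<rho> in auto)
  then have le_z: "measure lebesgue A \<le> measure lebesgue D * z"
    using m by (simp add: z_def field_simps)
  have "A \<subseteq> D"
    using thick pos by fastforce
  then have le_1: "measure lebesgue A \<le> measure lebesgue D"
    using A D by (intro measure_mono_fmeasurable) auto
  have z: "z > 0" using m pos by (simp add: z_def)
  have "measure lebesgue A \<le> measure lebesgue D * z powr \<alpha>"
  proof (cases "z \<le> 1")
    case True
    have "z powr 1 \<le> z powr \<alpha>"
      using True z \<alpha> by (intro powr_mono') auto
    then show ?thesis
      using le_z z mult_left_mono[of z "z powr \<alpha>" "measure lebesgue D"] by simp
  next
    case False
    then show ?thesis
      using le_1 ge_one_powr_ge_zero[of z \<alpha>] \<alpha> mult_left_mono[of 1 "z powr \<alpha>" "measure lebesgue D"]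
      by simp
  qed
  then show ?thesis
    by (simp add: z_def m_def mult_ac)
qed

text \<open>The ball lies in the ball of radius \<open>3 * R\<close> around the origin. On the shell of outer radius
  \<open>s = 3 * R / 2 ^ i\<close> the gap scale is smaller than for the whole ball by a factor of at most
  \<open>2 powr (i * \<beta>)\<close>, which costs the factor \<open>2 powr (i * \<alpha> * \<beta>)\<close>, while the measure of the shell gains
  \<open>2 powr (- i * n)\<close>. The hypothesis \<open>\<alpha> * \<beta> < n\<close> makes the sum over the shells finite.\<close>

lemma central_ball_density:
  fixes x :: "real ^ 'n"
  assumes \<alpha>: "0 \<le> \<alpha>" "\<alpha> \<le> 1" "\<alpha> * \<beta> < CARD('n)"
    and R: "R > 0" "norm x < 2 * R" and r: "r > 0"
  shows "measure lebesgue (nbhd (spheres T) r \<inter> ball x R)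
    \<le> measure lebesgue (ball (0 :: real ^ 'n) 1) * 6 ^ CARD('n)
        / (1 - 2 powr (\<alpha> * \<beta> - CARD('n))) * (32 / \<kappa>) powr \<alpha>
        * R ^ CARD('n) * (r / gap_scale x R) powr \<alpha>"
proof -
  let ?n = "CARD('n)"
  let ?w = "measure lebesgue (ball (0 :: real ^ 'n) 1)"
  define q where "q = 2 powr (\<alpha> * \<beta> - ?n)"
  define s where "s i = 3 * R / 2 ^ i" for i :: nat
  define S :: "nat \<Rightarrow> (real ^ 'n) set" where
    "S i = nbhd (spheres T) r \<inter> (ball 0 (s i) - ball 0 (s i / 2))" for i
  define B where "B = ?w * 6 ^ ?n * (32 / \<kappa>) powr \<alpha> * R ^ ?n * (r / gap_scale x R) powr \<alpha>"
  have q: "0 < q" "q < 1"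
  proof -
    have "q < 2 powr 0"
      unfolding q_def using \<alpha> by (intro powr_less_mono) auto
    then show "q < 1" by simp
  qed (simp add: q_def)
  have B: "B \<ge> 0"
    unfolding B_def using R by (intro mult_nonneg_nonneg) auto
  have s: "s i > 0" for i
    using R by (simp add: s_def)
  have S_meas: "S i \<in> lmeasurable" for i
  proof -
    have "S i = (nbhd (spheres T) r \<inter> ball 0 (s i)) - ball 0 (s i / 2)"
      by (auto simp: S_def)
    also have "\<dots> \<in> lmeasurable"
      by (intro fmeasurable.Diff lmeasurable_nbhd_Int_ball) auto
    finally show ?thesis .
  qed
  have shell: "measure lebesgue (S i) \<le> B * q ^ i" for i
  proof -
    have "measure lebesgue (S i) \<le> measure lebesgue (ball (0 :: real ^ 'n) (2 * s i))
        * (32 / \<kappa> * (r / min (s i) (s i powr \<beta>))) powr \<alpha>"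
    proof (rule annulus_density)
      show "ball y (s i) \<subseteq> ball 0 (2 * s i)" if "y \<in> S i" for y
      proof
        fix z assume "z \<in> ball y (s i)"
        then show "z \<in> ball 0 (2 * s i)"
          using that norm_triangle_ineq[of y "z - y"] by (simp add: S_def dist_norm norm_minus_commute)
      qed
    qed (use S_meas s r \<alpha> in \<open>auto simp: S_def\<close>)
    also have "measure lebesgue (ball (0 :: real ^ 'n) (2 * s i)) = ?w * 6 ^ ?n * R ^ ?n / 2 ^ (i * ?n)"
      using s[of i] by (subst measure_ball_eq) (auto simp: s_def power_mult_distrib power_divide power_mult)
    also have "(32 / \<kappa> * (r / min (s i) (s i powr \<beta>))) powr \<alpha>
        \<le> (32 / \<kappa> * (r / gap_scale x R) * 2 powr (real i * \<beta>)) powr \<alpha>"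
    proof (rule powr_mono2)
      have "gap_scale x R / 2 powr (real i * \<beta>) \<le> min (s i) (s i powr \<beta>)"
      proof (rule min.boundedI)
        have "gap_scale x R / 2 powr (real i * \<beta>) \<le> 3 * R / 2 powr (real i * 1)"
          using gap_scale_le[of x R] R exponent gap_scale_pos[of R x]
          by (intro frac_le powr_mono mult_left_mono) auto
        then show "gap_scale x R / 2 powr (real i * \<beta>) \<le> s i"
          by (simp add: s_def powr_realpow)
        have "gap_scale x R \<le> (3 * R) powr \<beta>"
        proof -
          have "gap_scale x R \<le> (norm x + R) powr \<beta>" by (simp add: gap_scale_def)
          also have "\<dots> \<le> (3 * R) powr \<beta>"
            using R exponent by (intro powr_mono2) auto
          finally show ?thesis .
        qed
        then have "gap_scale x R / 2 powr (real i * \<beta>) \<le> (3 * R) powr \<beta> / 2 powr (real i * \<beta>)"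
          by (intro divide_right_mono) auto
        also have "\<dots> = s i powr \<beta>"
        proof -
          have "s i = 3 * R / 2 powr real i" by (simp add: s_def powr_realpow)
          then show ?thesis using R by (simp only: powr_divide powr_powr)
        qed
        finally show "gap_scale x R / 2 powr (real i * \<beta>) \<le> s i powr \<beta>" .
      qed
      then have "gap_scale x R \<le> 2 powr (real i * \<beta>) * min (s i) (s i powr \<beta>)"
        by (simp only: pos_divide_le_eq powr_gt_zero mult.commute)
      moreover have "0 < min (s i) (s i powr \<beta>)"
        using s[of i] by (simp add: min_def)
      ultimately have "32 / \<kappa> * (r / min (s i) (s i powr \<beta>))
          \<le> 32 / \<kappa> * (2 powr (real i * \<beta>) * (r / gap_scale x R))"
        using r \<kappa>_pos gap_scale_pos[OF R(1), of x] by (intro divide_le_mult_divide) simp_all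
      then show "32 / \<kappa> * (r / min (s i) (s i powr \<beta>)) \<le> 32 / \<kappa> * (r / gap_scale x R) * 2 powr (real i * \<beta>)"
        by (simp only: mult_ac)
    qed (use \<alpha> \<kappa>_pos r less_imp_le[OF s] in \<open>auto simp: min_def\<close>)
    also have "\<dots> = (32 / \<kappa>) powr \<alpha> * (r / gap_scale x R) powr \<alpha> * 2 powr (real i * \<beta> * \<alpha>)"
    proof -
      have "(u * v * 2 powr e) powr \<alpha> = u powr \<alpha> * v powr \<alpha> * 2 powr (e * \<alpha>)"
        if "u \<ge> 0" "v \<ge> 0" for u v e :: real
        using that by (simp add: powr_mult powr_powr)
      from this[of "32 / \<kappa>" "r / gap_scale x R" "real i * \<beta>"] show ?thesis
        using \<kappa>_pos r gap_scale_pos[OF R(1), of x] by simp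
    qed
    finally have "measure lebesgue (S i) \<le> ?w * 6 ^ ?n * R ^ ?n / 2 ^ (i * ?n)
        * ((32 / \<kappa>) powr \<alpha> * (r / gap_scale x R) powr \<alpha> * 2 powr (real i * \<beta> * \<alpha>))"
      by this (use R in \<open>intro mult_left_mono; simp\<close>)
    also have "\<dots> = B * (2 powr (real i * \<beta> * \<alpha>) / 2 ^ (i * ?n))"
      by (simp add: B_def)
    also have "2 powr (real i * \<beta> * \<alpha>) / 2 ^ (i * ?n) = q ^ i"
    proof -
      have "q ^ i = q powr (real i)" using q by (simp add: powr_realpow)
      also have "\<dots> = 2 powr (real i * \<beta> * \<alpha> - real (i * ?n))"
        by (simp add: q_def powr_powr algebra_simps)
      also have "\<dots> = 2 powr (real i * \<beta> * \<alpha>) / 2 powr (real (i * ?n))"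
        by (rule powr_diff)
      finally show ?thesis by (simp only: powr_realpow)
    qed
    finally show ?thesis .
  qed
  have cover: "nbhd (spheres T) r \<inter> ball x R \<subseteq> insert 0 (\<Union>i. S i)"
  proof
    fix y assume y: "y \<in> nbhd (spheres T) r \<inter> ball x R"
    show "y \<in> insert 0 (\<Union>i. S i)"
    proof (cases "y = 0")
      case False
      have y_less: "norm y < 3 * R"
        using y R norm_triangle_ineq[of x "y - x"] by (simp add: dist_norm norm_minus_commute)
      have "\<exists>k. s k \<le> norm y"
      proof -
        obtain k where "(1 / 2) ^ k < norm y / (3 * R)"
          using real_arch_pow_inv[of "norm y / (3 * R)" "1 / 2"] False R by auto
        then show ?thesis
          using R by (intro exI[of _ k]) (simp add: s_def field_simps)
      qed
      then obtain k where k: "s k \<le> norm y" "\<forall>j<k. \<not> s j \<le> norm y"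
        using exists_least_iff[of "\<lambda>k. s k \<le> norm y"] by blast
      have "k \<noteq> 0"
        using k(1) y_less by (intro notI) (simp add: s_def)
      then have "s k = s (k - 1) / 2"
        by (cases k) (auto simp: s_def)
      moreover have "norm y < s (k - 1)"
        using k(2) \<open>k \<noteq> 0\<close> by (meson diff_less neq0_conv not_le zero_less_one)
      ultimately have "y \<in> S (k - 1)"
        using y k(1) by (auto simp: S_def)
      then show ?thesis by blast
    qed simp
  qed
  have union: "measure lebesgue (\<Union>i\<le>N. S i) \<le> B / (1 - q)" for N
  proof -
    have "measure lebesgue (\<Union>i\<le>N. S i) \<le> (\<Sum>i\<le>N. measure lebesgue (S i))"
      using S_meas by (intro measure_UNION_le fmeasurableD) auto
    also have "\<dots> \<le> (\<Sum>i\<le>N. B * q ^ i)" by (intro sum_mono shell)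
    also have "\<dots> = B * (\<Sum>i<Suc N. q ^ i)" by (simp add: sum_distrib_left lessThan_Suc_atMost)
    also have "\<dots> = B * ((1 - q ^ Suc N) / (1 - q))"
      using q by (subst sum_gp_strict) auto
    also have "\<dots> \<le> B * (1 / (1 - q))"
      using q B by (intro mult_left_mono divide_right_mono) auto
    finally show ?thesis by simp
  qed
  have U: "(\<Union>i. S i) \<in> lmeasurable"
    using S_meas union by (rule fmeasurable_countable_Union)
  have "measure lebesgue (nbhd (spheres T) r \<inter> ball x R) \<le> measure lebesgue (insert 0 (\<Union>i. S i))"
  proof (intro measure_mono_fmeasurable cover fmeasurableD lmeasurable_nbhd_Int_ball)
    show "insert 0 (\<Union>i. S i) \<in> lmeasurable"
      using fmeasurable.Un[OF lmeasurable_compact[OF compact_sing[of 0]] U] by simp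
  qed
  also have "\<dots> = measure lebesgue (\<Union>i. S i)"
    using U by (intro measure_negligible_symdiff) (auto intro: negligible_subset[of "{0}"])
  also have "\<dots> \<le> B / (1 - q)"
    using S_meas union by (rule measure_countable_Union_le)
  finally show ?thesis by (simp add: B_def q_def)
qed

text \<open>Here the ball lies in the annulus around \<open>s = |x|\<close>, and \<open>|x|\<close> and \<open>|x| + R\<close> are comparable, so that
  one application of the annulus estimate suffices.\<close>

lemma off_centre_ball_density:
  fixes x :: "real ^ 'n"
  assumes \<alpha>: "0 \<le> \<alpha>" "\<alpha> \<le> 1"
    and R: "R > 0" "2 * R \<le> norm x" and r: "r > 0"
  shows "measure lebesgue (nbhd (spheres T) r \<inter> ball x R)
    \<le> measure lebesgue (ball (0 :: real ^ 'n) 1) * 2 ^ CARD('n) * (32 * 2 powr \<beta> / \<kappa>) powr \<alpha>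
        * R ^ CARD('n) * (r / gap_scale x R) powr \<alpha>"
proof -
  let ?n = "CARD('n)"
  let ?w = "measure lebesgue (ball (0 :: real ^ 'n) 1)"
  let ?s = "norm x"
  have "measure lebesgue (nbhd (spheres T) r \<inter> ball x R) \<le> measure lebesgue (ball x (2 * R))
      * (32 / \<kappa> * (r / min R (?s powr \<beta>))) powr \<alpha>"
  proof (rule annulus_density)
    show "?s / 2 \<le> norm y \<and> norm y \<le> 2 * ?s" if "y \<in> nbhd (spheres T) r \<inter> ball x R" for y
    proof -
      have "\<bar>norm x - norm y\<bar> < R"
        using that norm_triangle_ineq3[of x y] by (simp add: dist_norm)
      then show ?thesis using R by linarith
    qed
    show "ball y R \<subseteq> ball x (2 * R)" if "y \<in> nbhd (spheres T) r \<inter> ball x R" for y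
    proof
      fix z assume "z \<in> ball y R"
      then show "z \<in> ball x (2 * R)" using that dist_triangle[of x z y] by simp
    qed
  qed (use R r \<alpha> in \<open>auto intro: lmeasurable_nbhd_Int_ball\<close>)
  also have "(32 / \<kappa> * (r / min R (?s powr \<beta>))) powr \<alpha>
      \<le> (32 * 2 powr \<beta> / \<kappa> * (r / gap_scale x R)) powr \<alpha>"
  proof (rule powr_mono2)
    have s: "?s > 0" using R by linarith
    have "gap_scale x R \<le> 2 powr \<beta> * min R (?s powr \<beta>)"
    proof -
      have "R \<le> 2 powr \<beta> * R"
        using R exponent by (simp add: ge_one_powr_ge_zero)
      moreover have "(?s + R) powr \<beta> \<le> 2 powr \<beta> * ?s powr \<beta>"
        using R exponent powr_mono2[of \<beta> "?s + R" "2 * ?s"] by (simp add: powr_mult)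
      ultimately show ?thesis by (simp add: gap_scale_def min_def)
    qed
    moreover have "0 < min R (?s powr \<beta>)"
      using R s by (simp add: min_def)
    ultimately have "32 / \<kappa> * (r / min R (?s powr \<beta>)) \<le> 32 / \<kappa> * (2 powr \<beta> * (r / gap_scale x R))"
      using r \<kappa>_pos gap_scale_pos[OF R(1), of x] by (intro divide_le_mult_divide) simp_all
    then show "32 / \<kappa> * (r / min R (?s powr \<beta>)) \<le> 32 * 2 powr \<beta> / \<kappa> * (r / gap_scale x R)"
      by (simp add: mult_ac)
  qed (use \<alpha> \<kappa>_pos r R in \<open>auto simp: min_def\<close>)
  also have "\<dots> = (32 * 2 powr \<beta> / \<kappa>) powr \<alpha> * (r / gap_scale x R) powr \<alpha>"
    using \<kappa>_pos r gap_scale_pos[OF R(1), of x] by (subst powr_mult) auto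
  finally show ?thesis
    using R measure_ball_eq[of "2 * R" x] by (simp add: mult_left_mono power_mult_distrib mult_ac)
qed

lemma nbhd_density:
  assumes \<alpha>: "0 \<le> \<alpha>" "\<alpha> \<le> 1" "\<alpha> * \<beta> < CARD('n)"
  obtains C where "C > 0" and
    "\<And>(x :: real ^ 'n) R r. R > 0 \<Longrightarrow> r > 0 \<Longrightarrow>
       measure lebesgue (nbhd (spheres T) r \<inter> ball x R) / measure lebesgue (ball x R)
         \<le> C * (r / gap_scale x R) powr \<alpha>"
proof -
  let ?w = "measure lebesgue (ball (0 :: real ^ 'n) 1)"
  define C1 where "C1 = 6 ^ CARD('n) / (1 - 2 powr (\<alpha> * \<beta> - CARD('n))) * (32 / \<kappa>) powr \<alpha>"
  define C2 where "C2 = 2 ^ CARD('n) * (32 * 2 powr \<beta> / \<kappa>) powr \<alpha>"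
  have w: "?w > 0" by simp
  have "C2 > 0" using \<kappa>_pos by (simp add: C2_def)
  show ?thesis
  proof (rule that[of "max C1 C2"])
    show "max C1 C2 > 0" using \<open>C2 > 0\<close> by simp
    fix x :: "real ^ 'n" and R r :: real assume R: "R > 0" and r: "r > 0"
    let ?z = "(r / gap_scale x R) powr \<alpha>"
    have "measure lebesgue (nbhd (spheres T) r \<inter> ball x R) \<le> C1 * ?z * (?w * R ^ CARD('n))
        \<or> measure lebesgue (nbhd (spheres T) r \<inter> ball x R) \<le> C2 * ?z * (?w * R ^ CARD('n))"
      using central_ball_density[OF \<alpha> R _ r, of x] off_centre_ball_density[OF \<alpha>(1,2) R _ r, of x]
      by (cases "norm x < 2 * R") (auto simp: C1_def C2_def mult_ac)
    moreover have "C1 * ?z * (?w * R ^ CARD('n)) \<le> max C1 C2 * ?z * (?w * R ^ CARD('n))"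
      "C2 * ?z * (?w * R ^ CARD('n)) \<le> max C1 C2 * ?z * (?w * R ^ CARD('n))"
      using R w by (intro mult_right_mono; simp)+
    ultimately have "measure lebesgue (nbhd (spheres T) r \<inter> ball x R) \<le> max C1 C2 * ?z * (?w * R ^ CARD('n))"
      by linarith
    then show "measure lebesgue (nbhd (spheres T) r \<inter> ball x R) / measure lebesgue (ball x R)
        \<le> max C1 C2 * ?z"
      using R w measure_ball_eq[of R x] by (subst pos_divide_le_eq) auto
  qed
qed

end

section \<open>Cubes\<close>

lemma half_open_cube_measure:
  fixes a :: "real ^ 'n"
  assumes "l > 0"
  shows "half_open_cube a l \<in> lmeasurable" "measure lebesgue (half_open_cube a l) = l ^ CARD('n)"
proof -
  let ?b = "\<chi> i. a $ i + l"
  have sub: "box a ?b \<subseteq> half_open_cube a l" "half_open_cube a l \<subseteq> cbox a ?b"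
    by (auto simp: half_open_cube_def mem_box_cart order_less_imp_le)
  have "half_open_cube a l = (\<Inter>i. {x. a $ i \<le> x $ i} \<inter> {x. x $ i < a $ i + l})"
    by (auto simp: half_open_cube_def)
  also have "\<dots> \<in> sets borel"
    by (intro sets.countable_INT'' sets.Int borel_closed borel_open closed_Collect_le open_Collect_less
        continuous_intros) auto
  finally have "half_open_cube a l \<in> sets lebesgue" by simp
  with sub(2) show lm: "half_open_cube a l \<in> lmeasurable"
    by (intro fmeasurableI2[OF lmeasurable_cbox])
  have "measure lebesgue (cbox a ?b) = l ^ CARD('n)"
    using assms by (simp add: content_cbox_if_cart interval_eq_empty_cart not_less)
  moreover have "measure lebesgue (box a ?b) = measure lebesgue (cbox a ?b)"
    by (simp add: measure_lborel_box_eq measure_lborel_cbox_eq)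
  ultimately show "measure lebesgue (half_open_cube a l) = l ^ CARD('n)"
    using measure_mono_fmeasurable[OF sub(1) _ lm] measure_mono_fmeasurable[OF sub(2) fmeasurableD[OF lm]]
    by fastforce
qed

lemma dist_less_in_half_open_cube:
  fixes x y :: "real ^ 'n"
  assumes "x \<in> half_open_cube a l" "y \<in> half_open_cube a l"
  shows "dist x y < real CARD('n) * l"
proof -
  have "dist x y \<le> (\<Sum>i\<in>UNIV. \<bar>(x - y) $ i\<bar>)"
    unfolding dist_norm by (rule norm_le_l1_cart)
  also have "\<dots> < (\<Sum>i\<in>(UNIV :: 'n set). l)"
  proof (rule sum_strict_mono)
    fix i
    have "a $ i \<le> x $ i" "x $ i < a $ i + l" "a $ i \<le> y $ i" "y $ i < a $ i + l"
      using assms by (auto simp: half_open_cube_def)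
    then show "\<bar>(x - y) $ i\<bar> < l" by (simp add: abs_less_iff)
  qed auto
  finally show ?thesis by simp
qed

lemma ball_subset_half_open_cube:
  "ball ((\<chi> i. a $ i + l / 2) :: real ^ 'n) (l / 2) \<subseteq> half_open_cube a l"
proof
  fix x assume "x \<in> ball ((\<chi> i. a $ i + l / 2) :: real ^ 'n) (l / 2)"
  then have "\<bar>(x - (\<chi> i. a $ i + l / 2)) $ i\<bar> < l / 2" for i
    using component_le_norm_cart[of "x - (\<chi> i. a $ i + l / 2)" i]
    by (simp add: dist_norm norm_minus_commute)
  then show "x \<in> half_open_cube a l"
    by (simp add: half_open_cube_def abs_less_iff algebra_simps less_imp_le)
       (smt (verit) field_sum_of_halves)
qed

text \<open>The index of the grid cube containing a point is read off from the point, so the cubes of a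
  grid are disjoint and cover.\<close>

lemma mem_grid_cube_iff:
  fixes z :: "real ^ 'n"
  assumes "q > 0"
  shows "z \<in> half_open_cube (\<chi> i. a $ i + real (k i) * q) q
    \<longleftrightarrow> (\<forall>i. a $ i \<le> z $ i \<and> k i = nat \<lfloor>(z $ i - a $ i) / q\<rfloor>)"
proof -
  have "(a $ i + real (k i) * q \<le> z $ i \<and> z $ i < a $ i + real (k i) * q + q)
    \<longleftrightarrow> a $ i \<le> z $ i \<and> k i = nat \<lfloor>(z $ i - a $ i) / q\<rfloor>" for i
  proof
    assume l: "a $ i + real (k i) * q \<le> z $ i \<and> z $ i < a $ i + real (k i) * q + q"
    have "a $ i + 0 \<le> a $ i + real (k i) * q"
      using assms by (intro add_left_mono) simp
    then have "a $ i \<le> z $ i" using l by linarith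
    moreover have "\<lfloor>(z $ i - a $ i) / q\<rfloor> = int (k i)"
      using l assms by (intro floor_unique) (simp_all add: field_simps)
    ultimately show "a $ i \<le> z $ i \<and> k i = nat \<lfloor>(z $ i - a $ i) / q\<rfloor>" by simp
  next
    assume r: "a $ i \<le> z $ i \<and> k i = nat \<lfloor>(z $ i - a $ i) / q\<rfloor>"
    define v where "v = (z $ i - a $ i) / q"
    have "v \<ge> 0" using r assms by (simp add: v_def)
    then have "real (k i) \<le> v" "v < real (k i) + 1"
      using r by (simp_all add: v_def[symmetric] of_nat_nat)
    then have "real (k i) * q \<le> v * q" "v * q < (real (k i) + 1) * q"
      using assms by auto
    moreover have "v * q = z $ i - a $ i" using assms by (simp add: v_def)
    ultimately show "a $ i + real (k i) * q \<le> z $ i \<and> z $ i < a $ i + real (k i) * q + q"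
      by (simp add: algebra_simps)
  qed
  then show ?thesis by (simp add: half_open_cube_def)
qed

lemma dyadic_gen_measure:
  fixes P :: "(real ^ 'n) set"
  assumes "Q \<in> dyadic_gen j P"
  shows "measure lebesgue Q = measure lebesgue P / 2 ^ (j * CARD('n))"
  using assms
  by (auto simp: dyadic_gen_def half_open_cube_measure power_divide power_mult)

lemma dyadicE:
  assumes "Q \<in> dyadic P"
  obtains b q where "q > 0" "Q = half_open_cube b q" "Q \<subseteq> P"
proof -
  obtain j a l k where Q: "Q = half_open_cube (\<chi> i. a $ i + real (k i) * (l / 2 ^ j)) (l / 2 ^ j)"
      "l > 0" "P = half_open_cube a l" "\<forall>i. k i < (2 :: nat) ^ j"
    using assms by (auto simp: dyadic_def dyadic_gen_def)
  have "Q \<subseteq> P"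
  proof
    fix z assume z: "z \<in> Q"
    have "a $ i \<le> z $ i \<and> z $ i < a $ i + l" for i
    proof -
      have "a $ i + real (k i) * (l / 2 ^ j) \<le> z $ i" "z $ i < a $ i + (real (k i) + 1) * (l / 2 ^ j)"
        using z by (auto simp: Q(1) half_open_cube_def algebra_simps add_divide_distrib)
      moreover have "0 \<le> real (k i) * (l / 2 ^ j)" using Q(2) by simp
      moreover have "real (k i) + 1 \<le> 2 ^ j"
        using Q(4) by (metis Suc_leI of_nat_Suc of_nat_le_iff of_nat_numeral of_nat_power add.commute)
      then have "(real (k i) + 1) * (l / 2 ^ j) \<le> 2 ^ j * (l / 2 ^ j)"
        using Q(2) by (intro mult_right_mono) auto
      ultimately show ?thesis by simp
    qed
    then show "z \<in> P" by (simp add: Q(3) half_open_cube_def)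
  qed
  with Q(1,2) show ?thesis by (intro that[of "l / 2 ^ j"]) auto
qed

text \<open>The measure of a dyadic subcube depends only on its generation, so a free subcube of the least possible
  generation is largest, and the maximum defining \<open>max_free_cube\<close> is attained.\<close>

lemma max_free_cube_free:
  fixes P :: "(real ^ 'n) set"
  assumes "Q \<in> dyadic P" "E \<inter> Q = {}"
  shows "max_free_cube E P \<in> dyadic P" "E \<inter> max_free_cube E P = {}"
proof -
  let ?free = "\<lambda>j. \<exists>Q\<in>dyadic_gen j P. E \<inter> Q = {}"
  have "\<exists>j. ?free j"
    using assms by (auto simp: dyadic_def)
  then obtain j where j: "?free j" "\<forall>i<j. \<not> ?free i"
    using exists_least_iff[of ?free] by blast
  then obtain Q' where Q': "Q' \<in> dyadic_gen j P" "E \<inter> Q' = {}" by blast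
  have "max_free_cube E P \<in> dyadic P \<and> E \<inter> max_free_cube E P = {}"
    unfolding max_free_cube_def
  proof (rule arg_maxI)
    show "Q' \<in> dyadic P \<and> E \<inter> Q' = {}"
      using Q' by (auto simp: dyadic_def)
    fix Q'' assume "Q'' \<in> dyadic P \<and> E \<inter> Q'' = {}"
    then obtain i where i: "Q'' \<in> dyadic_gen i P" "E \<inter> Q'' = {}"
      by (auto simp: dyadic_def)
    then have "j \<le> i" using j(2) by (meson not_less)
    then have "measure lebesgue P / 2 ^ (i * CARD('n)) \<le> measure lebesgue P / 2 ^ (j * CARD('n))"
      by (intro divide_left_mono power_increasing) auto
    then show "\<not> measure lebesgue Q'' > measure lebesgue Q'"
      by (simp add: dyadic_gen_measure[OF i(1)] dyadic_gen_measure[OF Q'(1)])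
  qed blast
  then show "max_free_cube E P \<in> dyadic P" "E \<inter> max_free_cube E P = {}" by auto
qed

section \<open>A criterion for weak porosity\<close>

text \<open>In a cube with corner \<open>a\<close>, take the dyadic generation whose cubes have diameter just below the width
  \<open>b * H a R\<close> of a neighbourhood of \<open>E\<close> that fills at most half of the cube. The cubes of this generation
  that meet \<open>E\<close> lie inside the neighbourhood, so the others, which are free, make up at least half of the
  cube. A free cube of any generation contains a hole of half its side length, which is at most
  \<open>K * H a R\<close>, so the largest one is longer by at most a constant factor.\<close>

lemma weakly_porousI:
  fixes E :: "(real ^ 'n) set" and H :: "real ^ 'n \<Rightarrow> real \<Rightarrow> real"
  assumes nonempty: "E \<noteq> {}" and K: "K > 0"
    and H: "\<And>x R. R > 0 \<Longrightarrow> 0 < H x R" "\<And>x R. R > 0 \<Longrightarrow> H x R \<le> R"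
    and free: "\<And>x y R t. y \<in> ball x R \<Longrightarrow> t \<le> R \<Longrightarrow> ball y t \<inter> E = {} \<Longrightarrow> t \<le> K * H x R"
    and thin: "\<And>\<epsilon>. \<epsilon> > 0 \<Longrightarrow> \<exists>b>0. b \<le> 1 \<and> (\<forall>x R. R > 0 \<longrightarrow>
       measure lebesgue (nbhd E (b * H x R) \<inter> ball x R) \<le> \<epsilon> * measure lebesgue (ball x R))"
  shows "weakly_porous E"
proof -
  let ?n = "CARD('n)"
  let ?w = "measure lebesgue (ball (0 :: real ^ 'n) 1)"
  have w: "?w > 0" by simp
  \<comment> \<open>A cube of side \<open>l\<close> lies in the ball of radius \<open>n * l\<close> around its corner; \<open>\<epsilon>\<close> times the measure of
    that ball is half the measure of the cube.\<close>
  define \<epsilon> where "\<epsilon> = 1 / (2 * ?w * real ?n ^ ?n)"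
  have "\<epsilon> > 0" using w by (simp add: \<epsilon>_def)
  then obtain b where b: "b > 0" "b \<le> 1" and thin_b: "\<And>x R. R > 0 \<Longrightarrow>
      measure lebesgue (nbhd E (b * H x R) \<inter> ball x R) \<le> \<epsilon> * measure lebesgue (ball x R)"
    using thin by blast
  define \<delta> where "\<delta> = min (1 / 2) ((b / (4 * real ?n * K)) ^ ?n)"
  have \<delta>: "0 < \<delta>" "\<delta> < 1" using b K by (auto simp: \<delta>_def)
  have "\<exists>N\<ge>1. \<exists>Q :: nat \<Rightarrow> (real ^ 'n) set.
      (\<forall>k\<in>{1..N}. Q k \<in> dyadic P \<and> E \<inter> Q k = {} \<and>
         measure lebesgue (Q k) \<ge> \<delta> * measure lebesgue (max_free_cube E P)) \<and>
      disjoint_family_on Q {1..N} \<and>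
      (\<Sum>k=1..N. measure lebesgue (Q k)) \<ge> 1 / 2 * measure lebesgue P"
    if cube_P: "is_cube P" for P
  proof -
    obtain a l where l: "l > 0" and P: "P = half_open_cube a l"
      using cube_P by (auto simp: is_cube_def)
    define R where "R = real ?n * l"
    define r where "r = b * H a R"
    have R: "R > 0" using l by (simp add: R_def)
    have r: "r > 0" "r \<le> R"
      using H[OF R, of a] b mult_mono[of b 1 "H a R" R] by (auto simp: r_def)
    have "a \<in> P" using l by (simp add: P half_open_cube_def)
    then have P_ball: "P \<subseteq> ball a R"
      using dist_less_in_half_open_cube by (auto simp: P R_def)
    have small: "measure lebesgue (nbhd E r \<inter> ball a R) \<le> l ^ ?n / 2"
    proof -
      have "\<epsilon> * measure lebesgue (ball a R) = l ^ ?n / 2"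
        using measure_ball_eq[of R a] R w
        by (simp add: \<epsilon>_def R_def power_mult_distrib del: measure_completion)
      then show ?thesis using thin_b[OF R, of a] by (simp only: r_def)
    qed
    obtain j where j: "R / 2 ^ j \<le> r" "r \<le> 2 * (R / 2 ^ j)"
    proof -
      have "\<exists>j. R / 2 ^ j \<le> r"
      proof -
        obtain j where "(1 / 2) ^ j < r / R"
          using real_arch_pow_inv[of "r / R" "1 / 2"] r R by auto
        then show ?thesis using R by (intro exI[of _ j]) (simp add: field_simps)
      qed
      then obtain j where j: "R / 2 ^ j \<le> r" "\<forall>i<j. \<not> R / 2 ^ i \<le> r"
        using exists_least_iff[of "\<lambda>j. R / 2 ^ j \<le> r"] by blast
      show ?thesis
      proof (cases j)
        case 0
        then show ?thesis using j r by (intro that[of 0]) auto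
      next
        case (Suc i)
        then have "\<not> R / 2 ^ i \<le> r" using j(2) by simp
        then show ?thesis using j Suc by (intro that[of j]) auto
      qed
    qed
    define q where "q = l / 2 ^ j"
    have q: "q > 0" and nq: "real ?n * q \<le> r" "r \<le> 2 * (real ?n * q)"
      using l j by (auto simp: q_def R_def)
    define cube where "cube k = half_open_cube (\<chi> i. a $ i + real (k i) * q) q" for k :: "'n \<Rightarrow> nat"
    define F where "F = {k. (\<forall>i. k i < (2 :: nat) ^ j) \<and> E \<inter> cube k = {}}"
    have "F \<subseteq> (\<Pi>\<^sub>E i\<in>UNIV. {..<2 ^ j})"
      by (auto simp: F_def)
    then have F_fin: "finite F"
      by (rule finite_subset) (intro finite_PiE; simp)
    have cube_meas: "cube k \<in> lmeasurable" "measure lebesgue (cube k) = q ^ ?n" for k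
      using q by (simp_all add: cube_def half_open_cube_measure)
    have cube_eq: "k = k'" if "z \<in> cube k" "z \<in> cube k'" for k k' z
      using that q by (auto simp: cube_def mem_grid_cube_iff fun_eq_iff)
    have cube_dyadic: "cube k \<in> dyadic P" if "k \<in> F" for k
      using that l unfolding dyadic_def dyadic_gen_def F_def cube_def q_def P by blast
    have cover: "P \<subseteq> (\<Union>k\<in>F. cube k) \<union> (nbhd E r \<inter> ball a R)"
    proof
      fix z assume z: "z \<in> P"
      define k where "k i = nat \<lfloor>(z $ i - a $ i) / q\<rfloor>" for i
      have az: "a $ i \<le> z $ i" "z $ i < a $ i + l" for i
        using z by (auto simp: P half_open_cube_def)
      have zk: "z \<in> cube k"
        unfolding cube_def mem_grid_cube_iff[OF q] using az by (simp add: k_def)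
      have k_less: "k i < 2 ^ j" for i
      proof -
        have "(z $ i - a $ i) / q < 2 ^ j"
          using az[of i] l mult_strict_right_mono[of "z $ i - a $ i" l "2 ^ j"]
          by (simp add: q_def pos_divide_less_eq mult.commute)
        then have "\<lfloor>(z $ i - a $ i) / q\<rfloor> < 2 ^ j"
          by (simp add: floor_less_iff)
        then show ?thesis by (simp add: k_def nat_less_iff)
      qed
      show "z \<in> (\<Union>k\<in>F. cube k) \<union> (nbhd E r \<inter> ball a R)"
      proof (cases "E \<inter> cube k = {}")
        case True
        then show ?thesis using zk k_less by (auto simp: F_def)
      next
        case False
        then obtain e where e: "e \<in> E" "e \<in> cube k" by blast
        have "dist z e < r"
          using dist_less_in_half_open_cube zk e(2) nq(1) unfolding cube_def by (metis less_le_trans)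
        then have "z \<in> nbhd E r"
          using infdist_le[OF e(1), of z] by (simp add: nbhd_def)
        then show ?thesis using z P_ball by auto
      qed
    qed
    have U: "(\<Union>k\<in>F. cube k) \<in> lmeasurable"
      using F_fin cube_meas by (intro fmeasurable.finite_UN) auto
    have "l ^ ?n = measure lebesgue P"
      using l by (simp add: P half_open_cube_measure)
    also have "\<dots> \<le> measure lebesgue ((\<Union>k\<in>F. cube k) \<union> (nbhd E r \<inter> ball a R))"
      using l U by (intro measure_mono_fmeasurable cover fmeasurable.Un lmeasurable_nbhd_Int_ball fmeasurableD)
        (auto simp: P half_open_cube_measure)
    also have "\<dots> \<le> measure lebesgue (\<Union>k\<in>F. cube k) + measure lebesgue (nbhd E r \<inter> ball a R)"
      using U by (intro measure_Un_le fmeasurableD lmeasurable_nbhd_Int_ball)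
    also have "\<dots> \<le> (\<Sum>k\<in>F. q ^ ?n) + l ^ ?n / 2"
      using measure_UNION_le[OF F_fin, of cube lebesgue] cube_meas small by (intro add_mono) auto
    finally have sum_ge: "l ^ ?n / 2 \<le> (\<Sum>k\<in>F. q ^ ?n)" by simp
    have "F \<noteq> {}"
    proof
      assume "F = {}"
      then show False using sum_ge zero_less_power[OF l, of ?n] by simp
    qed
    then obtain k0 where k0: "k0 \<in> F" by blast
    have max_le: "\<delta> * measure lebesgue (max_free_cube E P) \<le> q ^ ?n"
    proof -
      note M = max_free_cube_free[OF cube_dyadic[OF k0], of E]
      have "E \<inter> cube k0 = {}" using k0 by (simp add: F_def)
      from M[OF this] obtain b' q' where q': "q' > 0" "max_free_cube E P = half_open_cube b' q'"
          "max_free_cube E P \<subseteq> P" "E \<inter> max_free_cube E P = {}"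
        by (metis dyadicE)
      let ?y = "(\<chi> i. b' $ i + q' / 2) :: real ^ 'n"
      have "q' ^ ?n \<le> l ^ ?n"
      proof -
        have "measure lebesgue (half_open_cube b' q') \<le> measure lebesgue (half_open_cube a l)"
          using q' l by (intro measure_mono_fmeasurable fmeasurableD half_open_cube_measure) (auto simp: P)
        then show ?thesis using q'(1) l by (simp only: half_open_cube_measure)
      qed
      then have "q' \<le> l"
        using l q'(1) by simp
      moreover have "l \<le> R"
        using l mult_right_mono[of 1 "real ?n" l] by (simp add: R_def Suc_le_eq)
      moreover have ball: "ball ?y (q' / 2) \<subseteq> max_free_cube E P"
        unfolding q'(2) by (rule ball_subset_half_open_cube)
      moreover have "?y \<in> ball a R"
      proof -
        have "?y \<in> ball ?y (q' / 2)" using q'(1) by simp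
        then show ?thesis using ball q'(3) P_ball by blast
      qed
      ultimately have "q' / 2 \<le> K * H a R"
        using q'(1,4) by (intro free[of ?y]) auto
      then have "b * q' \<le> b * (2 * (K * H a R))"
        using b by (intro mult_left_mono) auto
      also have "\<dots> = 2 * K * r" by (simp add: r_def)
      also have "\<dots> \<le> 2 * K * (2 * (real ?n * q))"
        using nq K by (intro mult_left_mono) auto
      finally have "b / (4 * real ?n * K) * q' \<le> q"
        using K by (simp add: field_simps)
      then have "(b / (4 * real ?n * K) * q') ^ ?n \<le> q ^ ?n"
        using b K q' by (intro power_mono) auto
      moreover have "\<delta> * q' ^ ?n \<le> (b / (4 * real ?n * K)) ^ ?n * q' ^ ?n"
        using q' by (intro mult_right_mono) (auto simp: \<delta>_def)
      ultimately have "\<delta> * q' ^ ?n \<le> q ^ ?n"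
        by (simp only: power_mult_distrib)
      then show ?thesis
        using q'(1,2) by (simp only: half_open_cube_measure)
    qed
    obtain h where h: "bij_betw h {1..card F} F"
      using ex_bij_betw_nat_finite_1[OF F_fin] by blast
    have hF: "h i \<in> F" if "i \<in> {1..card F}" for i
      using h that by (auto simp: bij_betw_def)
    have "(\<Sum>k=1..card F. measure lebesgue (cube (h k))) = (\<Sum>k\<in>F. measure lebesgue (cube k))"
      by (rule sum.reindex_bij_betw[OF h])
    then have "1 / 2 * measure lebesgue P \<le> (\<Sum>k=1..card F. measure lebesgue (cube (h k)))"
      using sum_ge l by (simp add: P half_open_cube_measure cube_meas)
    moreover have "disjoint_family_on (\<lambda>i. cube (h i)) {1..card F}"
      unfolding disjoint_family_on_def
      using cube_eq h by (auto simp: bij_betw_def dest: inj_onD)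
    moreover have "\<forall>k\<in>{1..card F}. cube (h k) \<in> dyadic P \<and> E \<inter> cube (h k) = {} \<and>
         measure lebesgue (cube (h k)) \<ge> \<delta> * measure lebesgue (max_free_cube E P)"
      using hF cube_dyadic max_le by (simp only: cube_meas) (auto simp: F_def)
    moreover have "card F \<ge> 1"
      using \<open>F \<noteq> {}\<close> F_fin by (simp add: Suc_le_eq card_gt_0_iff)
    ultimately show ?thesis by (intro exI[of _ "card F"] conjI exI[of _ "\<lambda>i. cube (h i)"])
  qed
  then show ?thesis
    unfolding weakly_porous_def using nonempty \<delta>
    by (intro conjI exI[of _ "1 / 2"] exI[of _ \<delta>]) auto
qed

section \<open>Weak porosity and the Muckenhoupt exponent of concentric spheres\<close>

context power_gaps
begin

lemma thin_nbhd:
  assumes "\<epsilon> > 0"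
  shows "\<exists>b>0. b \<le> 1 \<and> (\<forall>(x :: real ^ 'n) R. R > 0 \<longrightarrow>
    measure lebesgue (nbhd (spheres T) (b * gap_scale x R) \<inter> ball x R) \<le> \<epsilon> * measure lebesgue (ball x R))"
proof -
  \<comment> \<open>Any positive exponent below \<open>min 1 (n / \<beta>)\<close> would do.\<close>
  define \<alpha> where "\<alpha> = 1 / (2 * \<beta>)"
  have \<alpha>: "\<alpha> > 0" "\<alpha> \<le> 1" "\<alpha> * \<beta> < CARD('n)"
  proof -
    have "\<alpha> * \<beta> = 1 / 2" using exponent by (simp add: \<alpha>_def)
    also have "\<dots> < real CARD('n)"
      by (rule less_le_trans[of _ 1]) (simp_all add: Suc_le_eq)
    finally show "\<alpha> * \<beta> < CARD('n)" .
  qed (use exponent in \<open>auto simp: \<alpha>_def\<close>)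
  obtain C where C: "C > 0" "\<And>(x :: real ^ 'n) R r. R > 0 \<Longrightarrow> r > 0 \<Longrightarrow>
      measure lebesgue (nbhd (spheres T) r \<inter> ball x R) / measure lebesgue (ball x R)
        \<le> C * (r / gap_scale x R) powr \<alpha>"
    using nbhd_density[of \<alpha>, where 'n = 'n] \<alpha> by auto
  define b where "b = min 1 ((\<epsilon> / C) powr (1 / \<alpha>))"
  have b: "b > 0" "b \<le> 1" using assms C by (auto simp: b_def)
  have "b powr \<alpha> \<le> ((\<epsilon> / C) powr (1 / \<alpha>)) powr \<alpha>"
    using b \<alpha> by (intro powr_mono2) (auto simp: b_def)
  also have "\<dots> = \<epsilon> / C"
    using \<alpha> assms C by (simp add: powr_powr)
  finally have b\<alpha>: "C * b powr \<alpha> \<le> \<epsilon>" using C by (simp add: field_simps)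
  have "measure lebesgue (nbhd (spheres T) (b * gap_scale x R) \<inter> ball x R) \<le> \<epsilon> * measure lebesgue (ball x R)"
    if R: "R > 0" for x :: "real ^ 'n" and R
  proof -
    have g: "gap_scale x R > 0" by (rule gap_scale_pos[OF R])
    have "measure lebesgue (nbhd (spheres T) (b * gap_scale x R) \<inter> ball x R) / measure lebesgue (ball x R) \<le> \<epsilon>"
      using C(2)[OF R, of "b * gap_scale x R" x] b g b\<alpha> by simp
    moreover have "measure lebesgue (ball x R) > 0" using R by simp
    ultimately show ?thesis by (simp only: pos_divide_le_eq)
  qed
  with b show ?thesis by blast
qed

theorem weakly_porous_spheres: "weakly_porous (spheres T :: (real ^ 'n) set)"
proof (rule weakly_porousI[of _ K gap_scale])
  show "K > 0" using K_ge_1 by simp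
  show "\<exists>b>0. b \<le> 1 \<and> (\<forall>(x :: real ^ 'n) R. R > 0 \<longrightarrow>
      measure lebesgue (nbhd (spheres T) (b * gap_scale x R) \<inter> ball x R) \<le> \<epsilon> * measure lebesgue (ball x R))"
    if "\<epsilon> > 0" for \<epsilon>
    using that by (rule thin_nbhd)
qed (rule spheres_nonempty gap_scale_pos gap_scale_le free_ball_radius_le; assumption)+

text \<open>Holes exist since a thin neighbourhood of the spheres does not cover the ball, and a point outside
  the neighbourhood is the centre of a hole.\<close>

lemma hole_radius_bounds:
  fixes x :: "real ^ 'n"
  assumes R: "R > 0"
  shows "0 < hole_radius (spheres T) x R" "hole_radius (spheres T) x R \<le> R"
    "hole_radius (spheres T) x R \<le> K * gap_scale x R"
proof -
  define S where "S = {t. t > 0 \<and> (\<exists>y\<in>ball x R. ball y t \<subseteq> ball x R - spheres T)}"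
  have bounds: "t \<le> R" "t \<le> K * gap_scale x R" if tS: "t \<in> S" for t
  proof -
    obtain y where y: "t > 0" "y \<in> ball x R" "ball y t \<subseteq> ball x R - spheres T"
      using tS by (auto simp: S_def)
    then have "dist y x + t \<le> R"
      using ball_subset_ball_iff[of y t x R] by auto
    then show "t \<le> R" using zero_le_dist[of y x] by linarith
    then show "t \<le> K * gap_scale x R"
      using y by (intro free_ball_radius_le[of y]) auto
  qed
  obtain b where b: "b > 0" "measure lebesgue (nbhd (spheres T) (b * gap_scale x R) \<inter> ball x R)
      \<le> 1 / 2 * measure lebesgue (ball x R)"
    using thin_nbhd[of "1 / 2", where 'n = 'n] R by auto
  let ?r = "b * gap_scale x R"
  have "measure lebesgue (ball x R) > 0" using R by simp
  then have "\<not> ball x R \<subseteq> nbhd (spheres T) ?r"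
    using b(2) by (auto simp: Int_absorb1)
  then obtain y where y: "y \<in> ball x R" "y \<notin> nbhd (spheres T) ?r" by blast
  define t where "t = min ?r (R - dist x y)"
  have "z \<notin> spheres T" if "dist y z < ?r" for z
    using y(2) that infdist_le[of z "spheres T" y] by (force simp: nbhd_def)
  moreover have "z \<in> ball x R" if "dist y z < R - dist x y" for z
    using that dist_triangle[of x z y] by simp
  ultimately have "ball y t \<subseteq> ball x R - spheres T"
    by (auto simp: t_def)
  moreover have t: "t > 0"
    using y b gap_scale_pos[OF R, of x] by (simp add: t_def)
  ultimately have tS: "t \<in> S" using y by (auto simp: S_def)
  then have hole: "hole_radius (spheres T) x R = Sup S"
    by (auto simp: hole_radius_def S_def Let_def)
  have "t \<le> Sup S"
    using tS bounds by (intro cSup_upper bdd_aboveI) auto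
  with t show "0 < hole_radius (spheres T) x R" by (simp add: hole)
  show "hole_radius (spheres T) x R \<le> R" "hole_radius (spheres T) x R \<le> K * gap_scale x R"
    unfolding hole using tS bounds by (auto intro!: cSup_least)
qed

text \<open>The set \<open>T\<close> of radii does not determine the
  dimension of the space, which the first argument supplies.\<close>

abbreviation Mu_admissible :: "('n :: finite) itself \<Rightarrow> real \<Rightarrow> real \<Rightarrow> bool" where
  "Mu_admissible _ \<alpha> C \<equiv> \<forall>x\<in>(spheres T :: (real ^ 'n) set). \<forall>r R.
     0 < r \<and> r < hole_radius (spheres T) x R \<and> hole_radius (spheres T) x R \<le> R \<longrightarrow>
       measure lebesgue (nbhd (spheres T) r \<inter> ball x R) / measure lebesgue (ball x R)
         \<le> C * (hole_radius (spheres T) x R / r) powr (- \<alpha>)"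

lemma Mu_spheres_eq_Sup:
  "Mu (spheres T :: (real ^ 'n) set) = Sup (ereal ` {\<alpha>. \<exists>C. Mu_admissible TYPE('n) \<alpha> C})"
  using hole_radius_bounds(1)[where 'n = 'n] by (simp add: Mu_def)

lemma Mu_admissible_below:
  assumes \<alpha>: "0 \<le> \<alpha>" "\<alpha> \<le> 1" "\<alpha> * \<beta> < CARD('n)"
  shows "\<exists>C. Mu_admissible TYPE('n :: finite) \<alpha> C"
proof -
  obtain C where C: "C > 0" "\<And>(x :: real ^ 'n) R r. R > 0 \<Longrightarrow> r > 0 \<Longrightarrow>
      measure lebesgue (nbhd (spheres T) r \<inter> ball x R) / measure lebesgue (ball x R)
        \<le> C * (r / gap_scale x R) powr \<alpha>"
    using nbhd_density[OF \<alpha>] by blast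
  have "measure lebesgue (nbhd (spheres T) r \<inter> ball x R) / measure lebesgue (ball x R)
         \<le> C * K powr \<alpha> * (hole_radius (spheres T) x R / r) powr (- \<alpha>)"
    if r: "0 < r" "r < hole_radius (spheres T) x R" "hole_radius (spheres T) x R \<le> R" for x :: "real ^ 'n" and r R
  proof -
    let ?h = "hole_radius (spheres T) x R"
    have R: "R > 0" using r by linarith
    have g: "gap_scale x R > 0" by (rule gap_scale_pos[OF R])
    have "r * ?h \<le> r * (K * gap_scale x R)"
      using r hole_radius_bounds(3)[OF R, of x] by (intro mult_left_mono) auto
    then have "r / gap_scale x R \<le> K * (r / ?h)"
      using r g by (simp add: field_simps)
    then have "(r / gap_scale x R) powr \<alpha> \<le> (K * (r / ?h)) powr \<alpha>"
      using r g \<alpha> by (intro powr_mono2) auto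
    also have "\<dots> = K powr \<alpha> * (?h / r) powr (- \<alpha>)"
    proof -
      have "(?h / r) powr (- \<alpha>) = (r / ?h) powr \<alpha>"
        using r by (simp add: powr_divide powr_minus)
      then show ?thesis
        using r K_ge_1 powr_mult[of K "r / ?h" \<alpha>] by simp
    qed
    finally have "C * (r / gap_scale x R) powr \<alpha> \<le> C * (K powr \<alpha> * (?h / r) powr (- \<alpha>))"
      using C(1) by (intro mult_left_mono) auto
    then show ?thesis
      using C(2)[OF R r(1), of x] by (simp only: mult.assoc)
  qed
  then show ?thesis by blast
qed

text \<open>The first bound comes from the shell between radii \<open>1\<close> and \<open>1 + r\<close>, the second from the ball around the
  origin of radius \<open>(r / K) powr (1 / \<beta>)\<close>, in which every point is within \<open>r\<close> of a sphere.\<close>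

lemma nbhd_lower_bounds:
  assumes r: "0 < r" "r < 1"
  shows "measure lebesgue (ball (0 :: real ^ 'n) 1) * r
      \<le> measure lebesgue (nbhd (spheres T) r \<inter> ball (0 :: real ^ 'n) 2)"
    and "measure lebesgue (ball (0 :: real ^ 'n) 1) * (r / K) powr (CARD('n) / \<beta>)
      \<le> measure lebesgue (nbhd (spheres T) r \<inter> ball (0 :: real ^ 'n) 2)"
proof -
  let ?n = "CARD('n)"
  let ?w = "measure lebesgue (ball (0 :: real ^ 'n) 1)"
  let ?M = "nbhd (spheres T) r \<inter> ball (0 :: real ^ 'n) 2"
  have "ball 0 (1 + r) - ball 0 1 \<subseteq> ?M"
  proof
    fix y :: "real ^ 'n" assume "y \<in> ball 0 (1 + r) - ball 0 1"
    then have y: "1 \<le> norm y" "norm y < 1 + r" by auto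
    define z where "z = (1 / norm y) *\<^sub>R y"
    have "norm z = 1" using y by (auto simp: z_def)
    then have "z \<in> spheres T" using one_mem by (simp add: spheres_def)
    moreover have "dist y z = norm y - 1"
    proof -
      have "y - z = ((norm y - 1) / norm y) *\<^sub>R y"
        using y by (simp add: z_def diff_divide_distrib scaleR_left_diff_distrib)
      then show ?thesis using y by (auto simp: dist_norm)
    qed
    ultimately have "infdist y (spheres T) < r"
      using infdist_le[of z "spheres T" y] y by linarith
    then show "y \<in> ?M" using y r by (simp add: nbhd_def)
  qed
  then have "measure lebesgue (ball (0 :: real ^ 'n) (1 + r) - ball 0 1) \<le> measure lebesgue ?M"
    by (intro measure_mono_fmeasurable lmeasurable_nbhd_Int_ball) auto
  then have "measure lebesgue (ball (0 :: real ^ 'n) (1 + r)) - ?w \<le> measure lebesgue ?M"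
    using measure_diff_le_measure_setdiff[of "ball (0 :: real ^ 'n) (1 + r)" lebesgue "ball 0 1"]
    by (simp del: measure_completion)
  then have shell: "?w * (1 + r) ^ ?n - ?w \<le> measure lebesgue ?M"
    using r measure_ball_eq[of "1 + r" "0 :: real ^ 'n"] by (simp del: measure_completion)
  have "1 + 1 * r \<le> 1 + real ?n * r"
    using r by (intro add_left_mono mult_right_mono) (auto simp: Suc_le_eq)
  also have "\<dots> \<le> (1 + r) ^ ?n"
    using r by (intro Bernoulli_inequality) simp
  finally have "?w * (1 + r) \<le> ?w * (1 + r) ^ ?n"
    by (intro mult_left_mono) auto
  with shell show "?w * r \<le> measure lebesgue ?M"
    by (simp add: distrib_left del: measure_completion)
  define \<rho> where "\<rho> = (r / K) powr (1 / \<beta>)"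
  have rK: "0 < r / K" "r / K \<le> 1" using r K_ge_1 by auto
  have \<rho>: "0 < \<rho>" "\<rho> \<le> 1"
    using rK exponent powr_mono2[of "1 / \<beta>" "r / K" 1] r by (auto simp: \<rho>_def)
  have "ball 0 \<rho> \<subseteq> ?M"
  proof
    fix y :: "real ^ 'n" assume y: "y \<in> ball 0 \<rho>"
    have "infdist y (spheres T) \<le> K * norm y powr \<beta>" by (rule infdist_spheres_le)
    also have "\<dots> < K * \<rho> powr \<beta>"
      using y exponent K_ge_1 by (intro mult_strict_left_mono powr_less_mono2) auto
    also have "\<dots> = r"
      using r exponent K_ge_1 by (simp add: \<rho>_def powr_powr)
    finally show "y \<in> ?M" using y \<rho> by (simp add: nbhd_def)
  qed
  then have "measure lebesgue (ball (0 :: real ^ 'n) \<rho>) \<le> measure lebesgue ?M"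
    by (intro measure_mono_fmeasurable lmeasurable_nbhd_Int_ball) auto
  moreover have "\<rho> ^ ?n = (r / K) powr (?n / \<beta>)"
    using \<rho> by (simp add: \<rho>_def powr_powr flip: powr_realpow)
  ultimately show "?w * (r / K) powr (CARD('n) / \<beta>) \<le> measure lebesgue ?M"
    using \<rho> measure_ball_eq[of \<rho> "0 :: real ^ 'n"] by simp
qed

text \<open>For the ball of radius 2 around the origin and \<open>r\<close> tending to 0, the neighbourhood has measure at
  least a constant times \<open>r powr \<mu>\<close> with \<open>\<mu> = min 1 (n / \<beta>)\<close>, while the inequality with exponent \<open>\<alpha>\<close> bounds it
  by a constant times \<open>r powr \<alpha>\<close>.\<close>

lemma Mu_admissible_le:
  assumes adm: "Mu_admissible TYPE('n :: finite) \<alpha> C"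
  shows "\<alpha> \<le> min 1 (CARD('n) / \<beta>)"
proof (rule ccontr)
  let ?w = "measure lebesgue (ball (0 :: real ^ 'n) 1)"
  let ?M = "\<lambda>r. measure lebesgue (nbhd (spheres T) r \<inter> ball (0 :: real ^ 'n) 2)"
  let ?V = "measure lebesgue (ball (0 :: real ^ 'n) 2)"
  define \<mu> where "\<mu> = min 1 (CARD('n) / \<beta>)"
  assume "\<not> \<alpha> \<le> min 1 (CARD('n) / \<beta>)"
  then have \<alpha>: "\<alpha> > \<mu>" by (simp only: \<mu>_def not_le)
  have V: "?V > 0" and w: "?w > 0" by simp_all
  define h where "h = hole_radius (spheres T) (0 :: real ^ 'n) 2"
  have h: "h > 0" "h \<le> 2"
    using hole_radius_bounds(1,2)[of 2 "0 :: real ^ 'n"] by (auto simp: h_def)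
  define c0 where "c0 = ?w * (1 / K) powr (CARD('n) / \<beta>)"
  have c0: "c0 > 0" using K_ge_1 w by (simp add: c0_def)
  have lower: "c0 * r powr \<mu> \<le> ?M r" if r: "0 < r" "r < 1" for r
  proof (cases "\<mu> = 1")
    case True
    have "c0 \<le> ?w * 1"
      unfolding c0_def using K_ge_1 exponent powr_mono2[of "CARD('n) / \<beta>" "1 / K" 1]
      by (intro mult_left_mono) auto
    then have "c0 * r \<le> ?w * r" using r by (intro mult_right_mono) auto
    then show ?thesis
      using nbhd_lower_bounds(1)[OF r, where 'n = 'n] True r by (simp only: powr_one order.strict_implies_order)
  next
    case False
    then have "\<mu> = CARD('n) / \<beta>" by (auto simp: \<mu>_def min_def split: if_splits)
    then show ?thesis
      using nbhd_lower_bounds(2)[OF r, where 'n = 'n] r K_ge_1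
      by (simp add: c0_def powr_divide)
  qed
  define C' where "C' = max C 1 * ?V * h powr (- \<alpha>)"
  have C': "C' > 0" using V h by (simp add: C'_def)
  have upper: "?M r \<le> C' * r powr \<alpha>" if r: "0 < r" "r < h" for r
  proof -
    have "0 \<in> (spheres T :: (real ^ 'n) set)" using zero_mem by (simp add: spheres_def)
    then have "?M r / ?V \<le> C * (h / r) powr (- \<alpha>)"
      using adm r h by (auto simp: h_def simp del: measure_completion)
    also have "\<dots> \<le> max C 1 * (h / r) powr (- \<alpha>)"
      by (intro mult_right_mono) auto
    also have "(h / r) powr (- \<alpha>) = h powr (- \<alpha>) * r powr \<alpha>"
      using r h by (simp add: powr_divide powr_minus_divide)
    finally show ?thesis
      unfolding C'_def using V by (simp only: pos_divide_le_eq mult_ac)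
  qed
  \<comment> \<open>Small enough that \<open>C' * r powr (\<alpha> - \<mu>) \<le> c0 / 2\<close>.\<close>
  define r where "r = min (min h 1 / 2) ((c0 / (2 * C')) powr (1 / (\<alpha> - \<mu>)))"
  have r: "0 < r" "r < h" "r < 1" using h c0 C' by (auto simp: r_def min_def)
  have "c0 * r powr \<mu> \<le> C' * r powr \<alpha>"
    using lower[of r] upper[of r] r by linarith
  also have "r powr \<alpha> = r powr (\<alpha> - \<mu>) * r powr \<mu>"
    by (simp flip: powr_add)
  finally have "c0 \<le> C' * r powr (\<alpha> - \<mu>)"
    using r by (simp add: mult.assoc[symmetric])
  also have "r powr (\<alpha> - \<mu>) \<le> ((c0 / (2 * C')) powr (1 / (\<alpha> - \<mu>))) powr (\<alpha> - \<mu>)"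
    using r \<alpha> by (intro powr_mono2) (auto simp: r_def)
  also have "\<dots> = c0 / (2 * C')"
    using \<alpha> c0 C' by (simp add: powr_powr)
  finally show False using c0 C' by simp
qed

theorem Mu_spheres: "Mu (spheres T :: (real ^ 'n) set) = ereal (min 1 (CARD('n) / \<beta>))"
proof (rule antisym)
  let ?A = "{\<alpha>. \<exists>C. Mu_admissible TYPE('n) \<alpha> C}"
  let ?\<mu> = "min 1 (CARD('n) / \<beta>)"
  have pos: "?\<mu> > 0" using exponent by simp
  show "Mu (spheres T :: (real ^ 'n) set) \<le> ereal ?\<mu>"
    unfolding Mu_spheres_eq_Sup using Mu_admissible_le[where 'n = 'n] by (intro Sup_least) auto
  show "ereal ?\<mu> \<le> Mu (spheres T :: (real ^ 'n) set)"
  proof (rule dense_le)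
    fix a assume a: "a < ereal ?\<mu>"
    obtain \<alpha> where \<alpha>: "a \<le> ereal \<alpha>" "0 \<le> \<alpha>" "\<alpha> < ?\<mu>"
    proof (cases a)
      case (real v)
      then show ?thesis using a pos by (intro that[of "max 0 v"]) auto
    qed (use a pos that[of 0] in auto)
    have "\<alpha> * \<beta> < CARD('n)" using \<alpha>(3) exponent by (simp add: field_simps)
    then have "\<alpha> \<in> ?A" using Mu_admissible_below[of \<alpha>] \<alpha> by auto
    then have "ereal \<alpha> \<le> Mu (spheres T :: (real ^ 'n) set)"
      unfolding Mu_spheres_eq_Sup by (intro Sup_upper imageI)
    with \<alpha>(1) show "a \<le> Mu (spheres T :: (real ^ 'n) set)" by simp
  qed
qed

end

theorem theorem7p1:
  fixes \<gamma> :: real and E :: "(real ^ 'n) set"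
  assumes "\<gamma> > 0"
    and "E = (\<Union>j\<in>{1::nat..}. sphere 0 (real j powr (- \<gamma>))) \<union> {0}"
  shows "weakly_porous E \<and>
         Mu E = ereal (min 1 (real CARD('n) * \<gamma> / (1 + \<gamma>)))"
proof -
  let ?T = "insert 0 ((\<lambda>j. real j powr - \<gamma>) ` {1::nat..})"
  interpret power_gaps ?T "1 + 1 / \<gamma>" \<gamma> "max 1 (\<gamma> * 2 powr (\<gamma> + 1))"
    by (rule power_gaps_reciprocal_powers[OF assms(1)])
  have "E = spheres ?T"
    unfolding assms(2) spheres_def by auto
  moreover have "CARD('n) / (1 + 1 / \<gamma>) = real CARD('n) * \<gamma> / (1 + \<gamma>)"
    using assms(1) by (simp add: field_simps)
  ultimately show ?thesis
    using weakly_porous_spheres[where 'n = 'n] Mu_spheres[where 'n = 'n] by simp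
qed

end
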